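(* Assume the linear model $Y_i=\beta^TX_i+\epsilon_i$, $i=1,\dots,n$, described in the context, and additionally that $\tau^2+\sigma^2=O(1)$ and $\frac{\|\mathbf{A}\|_F^2}{n^2}\to0$, where $\mathbf{A}=E(W_iW_i^T)$. Then $\hat\tau^2$ is consistent, i.e. $\hat\tau^2-\tau^2\overset{p}{\rightarrow}0$. Moreover, when (in the same model with $\tau^2+\sigma^2=O(1)$) the columns of $\mathbf{X}$ are independent and both $p/n$ and $E(X_{ij}^4)$ are bounded, then $\frac{\|\mathbf{A}\|_F^2}{n^2}\to0$ holds and $\hat\tau^2$ is $\sqrt n$-consistent.
   Context: Setting. $(X_1,Y_1),\dots,(X_n,Y_n)$ are i.i.d. with $X_i=(X_{i1},\dots,X_{ip})^T\in\mathbb{R}^p$, $Y_i=\beta^TX_i+\epsilon_i$, $E(\epsilon_i|X_i)=0$, $E(\epsilon_i^2|X_i)=\sigma^2$, $E(X_i)=0$, $\mathrm{Cov}(X_i)=\mathbf{I}$. $\mathbf{X}$ is the $n\times p$ design matrix with rows $X_i^T$. The signal level is $\tau^2=\|\beta\|^2$. Limits are as $n\to\infty$ with $p=p_n$; all quantities may depend on $n$. $W_{ij}=X_{ij}Y_i$, $W_i=(W_{i1},\dots,W_{ip})^T$, $\|\cdot\|_F$ is the Frobenius norm, and the naive estimator is $\hat\tau^2=\binom n2^{-1}\sum_{i_1<i_2}W_{i_1}^TW_{i_2}$. $\sqrt n$-consistent means $\sqrt n(\hat\tau^2-\tau^2)=O_p(1)$. Bounded means bounded uniformly over the indices and over $n$.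 *)

theory Defs
  imports "HOL-Probability.Probability" "HOL-Library.Landau_Symbols"
begin

text \<open>
  The dimension varies with the sample size, so vectors of length \<open>p\<close> are functions on \<open>nat\<close> of
  which only the arguments \<open>j < p\<close> matter, and \<open>X i j\<close> with \<open>i < n\<close>, \<open>j < p\<close> is the
  \<open>(i, j)\<close> entry of the random design matrix. Indices start at 0. Rows and columns are packaged
  as elements of a product space (hence the bounded abstractions).
\<close>

definition design_row :: "nat \<Rightarrow> (nat \<Rightarrow> nat \<Rightarrow> 'a \<Rightarrow> real) \<Rightarrow> nat \<Rightarrow> 'a \<Rightarrow> nat \<Rightarrow> real" where
  "design_row p X i \<omega> = (\<lambda>j\<in>{..<p}. X i j \<omega>)"

definition design_col :: "nat \<Rightarrow> (nat \<Rightarrow> nat \<Rightarrow> 'a \<Rightarrow> real) \<Rightarrow> nat \<Rightarrow> 'a \<Rightarrow> nat \<Rightarrow> real" where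
  "design_col n X j \<omega> = (\<lambda>i\<in>{..<n}. X i j \<omega>)"

abbreviation borel_vec :: "nat \<Rightarrow> (nat \<Rightarrow> real) measure" where
  "borel_vec m \<equiv> Pi\<^sub>M {..<m} (\<lambda>_. borel)"

definition sigma_gen :: "'a measure \<Rightarrow> 'b measure \<Rightarrow> ('a \<Rightarrow> 'b) \<Rightarrow> 'a measure" where
  "sigma_gen M N f = vimage_algebra (space M) f N"

definition cov :: "'a measure \<Rightarrow> ('a \<Rightarrow> real) \<Rightarrow> ('a \<Rightarrow> real) \<Rightarrow> real" where
  "cov M U V = (\<integral>\<omega>. (U \<omega> - (\<integral>\<omega>'. U \<omega>' \<partial>M)) * (V \<omega> - (\<integral>\<omega>'. V \<omega>' \<partial>M)) \<partial>M)"

text \<open>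
  The model for a single sample size \<open>n\<close> and dimension \<open>p\<close>. The integrability assumptions
  only make explicit that the (conditional) moments are meant to exist, because Bochner integrals
  and \<^const>\<open>real_cond_exp\<close> are total functions.
\<close>

locale linear_model = prob_space M
  for M :: "'a measure" +
  fixes n p :: nat
    and X :: "nat \<Rightarrow> nat \<Rightarrow> 'a \<Rightarrow> real"
    and Y \<epsilon> :: "nat \<Rightarrow> 'a \<Rightarrow> real"
    and \<beta> :: "nat \<Rightarrow> real"
    and \<sigma> :: real
  assumes indep:
      "indep_vars (\<lambda>_. borel_vec p \<Otimes>\<^sub>M borel) (\<lambda>i \<omega>. (design_row p X i \<omega>, Y i \<omega>)) {..<n}"
    and ident_distr:
      "\<And>i k. i < n \<Longrightarrow> k < n \<Longrightarrow>
        distr M (borel_vec p \<Otimes>\<^sub>M borel) (\<lambda>\<omega>. (design_row p X i \<omega>, Y i \<omega>)) =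
        distr M (borel_vec p \<Otimes>\<^sub>M borel) (\<lambda>\<omega>. (design_row p X k \<omega>, Y k \<omega>))"
    and linear:
      "\<And>i \<omega>. i < n \<Longrightarrow> \<omega> \<in> space M \<Longrightarrow> Y i \<omega> = (\<Sum>j<p. \<beta> j * X i j \<omega>) + \<epsilon> i \<omega>"
    and X_square_integrable: "\<And>i j. i < n \<Longrightarrow> j < p \<Longrightarrow> integrable M (\<lambda>\<omega>. (X i j \<omega>)\<^sup>2)"
    and X_mean: "\<And>i j. i < n \<Longrightarrow> j < p \<Longrightarrow> expectation (X i j) = 0"
    and X_cov:
      "\<And>i j k. i < n \<Longrightarrow> j < p \<Longrightarrow> k < p \<Longrightarrow> cov M (X i j) (X i k) = (if j = k then 1 else 0)"
    and noise_square_integrable: "\<And>i. i < n \<Longrightarrow> integrable M (\<lambda>\<omega>. (\<epsilon> i \<omega>)\<^sup>2)"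
    and noise_mean:
      "\<And>i. i < n \<Longrightarrow>
        AE \<omega> in M. real_cond_exp M (sigma_gen M (borel_vec p) (design_row p X i)) (\<epsilon> i) \<omega> = 0"
    and noise_var:
      "\<And>i. i < n \<Longrightarrow>
        AE \<omega> in M. real_cond_exp M (sigma_gen M (borel_vec p) (design_row p X i))
                     (\<lambda>\<omega>. (\<epsilon> i \<omega>)\<^sup>2) \<omega> = \<sigma>\<^sup>2"

definition signal_level :: "nat \<Rightarrow> (nat \<Rightarrow> real) \<Rightarrow> real" where
  "signal_level p \<beta> = (\<Sum>j<p. (\<beta> j)\<^sup>2)"

definition W :: "(nat \<Rightarrow> nat \<Rightarrow> 'a \<Rightarrow> real) \<Rightarrow> (nat \<Rightarrow> 'a \<Rightarrow> real) \<Rightarrow> nat \<Rightarrow> nat \<Rightarrow> 'a \<Rightarrow> real" where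
  "W X Y i j \<omega> = X i j \<omega> * Y i \<omega>"

text \<open>
  The matrix \<open>E(W\<^sub>i W\<^sub>i\<^sup>T)\<close> does not depend on \<open>i\<close>, since the observations are identically
  distributed; it is computed from the first observation.
\<close>

definition A_mat ::
  "'a measure \<Rightarrow> (nat \<Rightarrow> nat \<Rightarrow> 'a \<Rightarrow> real) \<Rightarrow> (nat \<Rightarrow> 'a \<Rightarrow> real) \<Rightarrow> nat \<Rightarrow> nat \<Rightarrow> real" where
  "A_mat M X Y j k = (\<integral>\<omega>. W X Y 0 j \<omega> * W X Y 0 k \<omega> \<partial>M)"

definition A_exists ::
  "'a measure \<Rightarrow> nat \<Rightarrow> (nat \<Rightarrow> nat \<Rightarrow> 'a \<Rightarrow> real) \<Rightarrow> (nat \<Rightarrow> 'a \<Rightarrow> real) \<Rightarrow> bool" where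
  "A_exists M p X Y \<longleftrightarrow>
    (\<forall>j<p. \<forall>k<p. integrable M (\<lambda>\<omega>. W X Y 0 j \<omega> * W X Y 0 k \<omega>))"

definition frobenius_norm :: "nat \<Rightarrow> (nat \<Rightarrow> nat \<Rightarrow> real) \<Rightarrow> real" where
  "frobenius_norm p B = sqrt (\<Sum>j<p. \<Sum>k<p. (B j k)\<^sup>2)"

definition naive_estimator ::
  "nat \<Rightarrow> nat \<Rightarrow> (nat \<Rightarrow> nat \<Rightarrow> 'a \<Rightarrow> real) \<Rightarrow> (nat \<Rightarrow> 'a \<Rightarrow> real) \<Rightarrow> 'a \<Rightarrow> real" where
  "naive_estimator n p X Y \<omega> =
    (\<Sum>i\<^sub>2<n. \<Sum>i\<^sub>1<i\<^sub>2. \<Sum>j<p. W X Y i\<^sub>1 j \<omega> * W X Y i\<^sub>2 j \<omega>) / real (n choose 2)"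

text \<open>
  Convergence in probability to 0 and stochastic boundedness for a sequence whose \<open>n\<close>-th member
  lives on its own probability space \<open>M n\<close>. Measurability is included because the measure of a
  non-measurable set is 0 by convention.
\<close>

definition tendsto_0_in_prob :: "(nat \<Rightarrow> 'a measure) \<Rightarrow> (nat \<Rightarrow> 'a \<Rightarrow> real) \<Rightarrow> bool" where
  "tendsto_0_in_prob M Z \<longleftrightarrow>
    (\<forall>\<^sub>F n in sequentially. Z n \<in> borel_measurable (M n)) \<and>
    (\<forall>e>0. (\<lambda>n. measure (M n) {\<omega> \<in> space (M n). \<bar>Z n \<omega>\<bar> > e}) \<longlonglongrightarrow> 0)"

definition bounded_in_prob :: "(nat \<Rightarrow> 'a measure) \<Rightarrow> (nat \<Rightarrow> 'a \<Rightarrow> real) \<Rightarrow> bool" where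
  "bounded_in_prob M Z \<longleftrightarrow>
    (\<forall>\<^sub>F n in sequentially. Z n \<in> borel_measurable (M n)) \<and>
    (\<forall>e>0. \<exists>K. \<forall>\<^sub>F n in sequentially. measure (M n) {\<omega> \<in> space (M n). \<bar>Z n \<omega>\<bar> > K} < e)"

definition consistent ::
  "(nat \<Rightarrow> 'a measure) \<Rightarrow> (nat \<Rightarrow> 'a \<Rightarrow> real) \<Rightarrow> (nat \<Rightarrow> real) \<Rightarrow> bool" where
  "consistent M T \<theta> \<longleftrightarrow> tendsto_0_in_prob M (\<lambda>n \<omega>. T n \<omega> - \<theta> n)"

definition root_n_consistent ::
  "(nat \<Rightarrow> 'a measure) \<Rightarrow> (nat \<Rightarrow> 'a \<Rightarrow> real) \<Rightarrow> (nat \<Rightarrow> real) \<Rightarrow> bool" where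
  "root_n_consistent M T \<theta> \<longleftrightarrow> bounded_in_prob M (\<lambda>n \<omega>. sqrt (real n) * (T n \<omega> - \<theta> n))"

end

theory Submission
  imports Defs "HOL-Real_Asymp.Real_Asymp"
begin

text \<open>
  The estimator is a U-statistic of order two in the independent, identically distributed vectors
  \<open>W\<^sub>i\<close>, whose mean is \<open>\<beta>\<close>. Everything follows from its second moment by Chebyshev's inequality.
  Centering, \<open>V\<^sub>i = W\<^sub>i - \<beta>\<close>, splits the error into the average of the \<open>V\<^sub>a\<^sup>T V\<^sub>b\<close> over all pairs
  and the linear term \<open>(2 / n) \<Sum>\<^sub>i \<beta>\<^sup>T V\<^sub>i\<close>. The summands of each part are uncorrelated, so with the
  covariance matrix \<open>S = A - \<beta> \<beta>\<^sup>T\<close> of \<open>V\<^sub>i\<close> the second moments of the two parts are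
  \<open>\<parallel>S\<parallel>\<^sub>F\<^sup>2\<close> divided by the number of pairs, and \<open>4 \<beta>\<^sup>T S \<beta> / n\<close>; this yields the bound
  \<open>16 (\<parallel>A\<parallel>\<^sub>F\<^sup>2 + \<tau>\<^sup>4) / n\<^sup>2 + 8 \<beta>\<^sup>T A \<beta> / n\<close> of \<open>naive_estimator_error_second_moment\<close>.

  Consistency: \<open>\<beta>\<^sup>T A \<beta> \<le> \<tau>\<^sup>2 \<parallel>A\<parallel>\<^sub>F\<close> by Cauchy and Schwarz, so if \<open>\<tau>\<^sup>2\<close> is bounded and
  \<open>\<parallel>A\<parallel>\<^sub>F / n\<close> tends to zero, then so does the bound.

  Rate: for independent columns, the mixed fourth moments of a row give the explicit form
  \<open>A = 2 \<beta> \<beta>\<^sup>T + diag d\<close> with bounded \<open>d\<close> (\<open>A_formula\<close>). Hence \<open>\<parallel>A\<parallel>\<^sub>F\<^sup>2 = O(1 + p) = O(n)\<close> and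
  \<open>\<beta>\<^sup>T A \<beta> = O(1)\<close>, and the second moment of the error is \<open>O(1 / n)\<close>.

  Both the orthogonality of the pairs and the fourth moments come from one fact on independent
  families, \<open>expectation_indep_prod_list\<close>, applied to the observations and to the columns.
\<close>

section \<open>Square-integrable functions and orthogonal sums\<close>

lemma integrable_mult_of_squares:
  fixes f g :: "'a \<Rightarrow> real"
  assumes [measurable]: "f \<in> borel_measurable M" "g \<in> borel_measurable M"
    and "integrable M (\<lambda>x. (f x)\<^sup>2)" "integrable M (\<lambda>x. (g x)\<^sup>2)"
  shows "integrable M (\<lambda>x. f x * g x)"
proof (rule Bochner_Integration.integrable_bound)
  show "integrable M (\<lambda>x. (f x)\<^sup>2 + (g x)\<^sup>2)"
    using assms by simp
  show "AE x in M. norm (f x * g x) \<le> norm ((f x)\<^sup>2 + (g x)\<^sup>2)"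
  proof (rule AE_I2)
    fix x
    have "2 * (\<bar>f x\<bar> * \<bar>g x\<bar>) \<le> (f x)\<^sup>2 + (g x)\<^sup>2"
      using sum_squares_bound[of "\<bar>f x\<bar>" "\<bar>g x\<bar>"] by simp
    moreover have "0 \<le> \<bar>f x\<bar> * \<bar>g x\<bar>" by simp
    ultimately have "\<bar>f x\<bar> * \<bar>g x\<bar> \<le> (f x)\<^sup>2 + (g x)\<^sup>2" by linarith
    then show "norm (f x * g x) \<le> norm ((f x)\<^sup>2 + (g x)\<^sup>2)"
      by (simp add: abs_mult)
  qed
qed simp

lemma integral_double_sum:
  fixes f :: "'i \<Rightarrow> 'k \<Rightarrow> 'a \<Rightarrow> real"
  assumes "\<And>i k. i \<in> I \<Longrightarrow> k \<in> K \<Longrightarrow> integrable M (f i k)"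
  shows "(\<integral>x. (\<Sum>i\<in>I. \<Sum>k\<in>K. f i k x) \<partial>M) = (\<Sum>i\<in>I. \<Sum>k\<in>K. \<integral>x. f i k x \<partial>M)"
proof -
  have "(\<integral>x. (\<Sum>i\<in>I. \<Sum>k\<in>K. f i k x) \<partial>M) = (\<Sum>i\<in>I. \<integral>x. (\<Sum>k\<in>K. f i k x) \<partial>M)"
    by (intro Bochner_Integration.integral_sum Bochner_Integration.integrable_sum assms)
  also have "\<dots> = (\<Sum>i\<in>I. \<Sum>k\<in>K. \<integral>x. f i k x \<partial>M)"
    by (intro sum.cong refl Bochner_Integration.integral_sum assms)
  finally show ?thesis .
qed

text \<open>
  Pythagoras: expanding the square leaves only the diagonal terms. The mixed products are assumed
  integrable, rather than every \<open>f i\<close> square integrable, because the case \<open>i = k\<close> covers the squares.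
\<close>

lemma
  fixes f :: "'i \<Rightarrow> 'a \<Rightarrow> real"
  assumes fin: "finite I"
    and int: "\<And>i k. i \<in> I \<Longrightarrow> k \<in> I \<Longrightarrow> integrable M (\<lambda>x. f i x * f k x)"
    and orth: "\<And>i k. i \<in> I \<Longrightarrow> k \<in> I \<Longrightarrow> i \<noteq> k \<Longrightarrow> (\<integral>x. f i x * f k x \<partial>M) = 0"
  shows integrable_orthogonal_sum: "integrable M (\<lambda>x. (\<Sum>i\<in>I. f i x)\<^sup>2)"
    and integral_orthogonal_sum: "(\<integral>x. (\<Sum>i\<in>I. f i x)\<^sup>2 \<partial>M) = (\<Sum>i\<in>I. \<integral>x. (f i x)\<^sup>2 \<partial>M)"
proof -
  show "integrable M (\<lambda>x. (\<Sum>i\<in>I. f i x)\<^sup>2)"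
    unfolding power2_eq_square sum_product by (intro Bochner_Integration.integrable_sum int)
  have "(\<integral>x. (\<Sum>i\<in>I. f i x)\<^sup>2 \<partial>M) = (\<Sum>i\<in>I. \<Sum>k\<in>I. \<integral>x. f i x * f k x \<partial>M)"
    unfolding power2_eq_square sum_product
    by (intro integral_double_sum int)
  also have "\<dots> = (\<Sum>i\<in>I. \<Sum>k\<in>I. if i = k then \<integral>x. (f i x)\<^sup>2 \<partial>M else 0)"
    by (intro sum.cong refl) (auto simp: orth power2_eq_square)
  finally show "(\<integral>x. (\<Sum>i\<in>I. f i x)\<^sup>2 \<partial>M) = (\<Sum>i\<in>I. \<integral>x. (f i x)\<^sup>2 \<partial>M)"
    using fin by simp
qed

section \<open>Products along an independent family\<close>

text \<open>
  A product of functions of the members of an independent family, with indices listed in any order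
  and with repetitions, is regrouped by index: the factors that carry the same index form one
  function of that member, and these functions are independent. An index that occurs only
  once and has a centered factor therefore makes the whole expectation vanish. Both uses below, for the
  observations and for the columns of one row, are products of this kind with two or four factors.
\<close>

lemma (in prob_space)
  fixes L :: "('i \<times> ('b \<Rightarrow> real)) list"
  assumes indep: "indep_vars N Z I" and fin: "finite I"
    and meas: "\<And>k g. (k, g) \<in> set L \<Longrightarrow> k \<in> I \<and> g \<in> borel_measurable (N k)"
    and int: "\<And>i. i \<in> I \<Longrightarrow>
      integrable M (\<lambda>\<omega>. prod_list (map (\<lambda>(k, g). if k = i then g (Z i \<omega>) else 1) L))"
  shows integrable_indep_prod_list:
      "integrable M (\<lambda>\<omega>. prod_list (map (\<lambda>(k, g). g (Z k \<omega>)) L))"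
    and expectation_indep_prod_list:
      "expectation (\<lambda>\<omega>. prod_list (map (\<lambda>(k, g). g (Z k \<omega>)) L)) =
        (\<Prod>i\<in>I. expectation (\<lambda>\<omega>. prod_list (map (\<lambda>(k, g). if k = i then g (Z i \<omega>) else 1) L)))"
proof -
  define h where "h i z = prod_list (map (\<lambda>(k, g). if k = i then g z else 1) L)" for i z
  have regroup: "prod_list (map (\<lambda>(k, g). g (Z k \<omega>)) L) = (\<Prod>i\<in>I. h i (Z i \<omega>))" for \<omega>
    using meas unfolding h_def
  proof (induction L)
    case (Cons a L)
    obtain k g where [simp]: "a = (k, g)" by (cases a)
    have "k \<in> I" using Cons.prems[of k g] by simp
    then show ?case
      using Cons.IH[OF Cons.prems] fin by (simp add: prod.distrib)
  qed simp
  have "h i \<in> borel_measurable (N i)" for i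
    using meas unfolding h_def
  proof (induction L)
    case (Cons a L)
    obtain k g where [simp]: "a = (k, g)" by (cases a)
    have "g \<in> borel_measurable (N k)" using Cons.prems[of k g] by simp
    moreover have "(\<lambda>z. prod_list (map (\<lambda>(k, g). if k = i then g z else 1) L)) \<in> borel_measurable (N i)"
      by (rule Cons.IH) (use Cons.prems in auto)
    ultimately show ?case by (cases "k = i") auto
  qed simp
  then have ind: "indep_vars (\<lambda>_. borel) (\<lambda>i \<omega>. h i (Z i \<omega>)) I"
    by (intro indep_vars_compose2[OF indep])
  have int': "integrable M (\<lambda>\<omega>. h i (Z i \<omega>))" if "i \<in> I" for i
    using int[OF that] by (simp add: h_def)
  show "integrable M (\<lambda>\<omega>. prod_list (map (\<lambda>(k, g). g (Z k \<omega>)) L))"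
    unfolding regroup by (rule indep_vars_integrable[OF fin ind int'])
  show "expectation (\<lambda>\<omega>. prod_list (map (\<lambda>(k, g). g (Z k \<omega>)) L)) =
        (\<Prod>i\<in>I. expectation (\<lambda>\<omega>. prod_list (map (\<lambda>(k, g). if k = i then g (Z i \<omega>) else 1) L)))"
    unfolding regroup h_def[symmetric] by (rule indep_vars_lebesgue_integral[OF fin ind int'])
qed

section \<open>The second moment of a degenerate U-statistic\<close>

text \<open>
  Independent centered vectors \<open>v j (Z i)\<close> with a common second moment matrix \<open>S\<close>. They are
  given as functions of an independent family \<open>Z\<close>, since independence is a property of whole
  observations and must pass to all coordinates at once.
\<close>

locale centered_sample = prob_space M
  for M :: "'a measure" +
  fixes n p :: nat
    and N :: "'b measure"
    and Z :: "nat \<Rightarrow> 'a \<Rightarrow> 'b"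
    and v :: "nat \<Rightarrow> 'b \<Rightarrow> real"
    and S :: "nat \<Rightarrow> nat \<Rightarrow> real"
  assumes indep: "indep_vars (\<lambda>_. N) Z {..<n}"
    and v_measurable: "\<And>j. j < p \<Longrightarrow> v j \<in> borel_measurable N"
    and v_square_integrable: "\<And>i j. i < n \<Longrightarrow> j < p \<Longrightarrow> integrable M (\<lambda>\<omega>. (v j (Z i \<omega>))\<^sup>2)"
    and v_mean: "\<And>i j. i < n \<Longrightarrow> j < p \<Longrightarrow> expectation (\<lambda>\<omega>. v j (Z i \<omega>)) = 0"
    and v_second_moment:
      "\<And>i j k. i < n \<Longrightarrow> j < p \<Longrightarrow> k < p \<Longrightarrow> expectation (\<lambda>\<omega>. v j (Z i \<omega>) * v k (Z i \<omega>)) = S j k"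
begin

definition inner :: "nat \<Rightarrow> nat \<Rightarrow> 'a \<Rightarrow> real" where
  "inner a b \<omega> = (\<Sum>j<p. v j (Z a \<omega>) * v j (Z b \<omega>))"

definition lin :: "(nat \<Rightarrow> real) \<Rightarrow> nat \<Rightarrow> 'a \<Rightarrow> real" where
  "lin c i \<omega> = (\<Sum>j<p. c j * v j (Z i \<omega>))"

lemma Z_measurable: "i < n \<Longrightarrow> Z i \<in> M \<rightarrow>\<^sub>M N"
  using indep by (auto simp: indep_vars_def)

lemma V_measurable: "i < n \<Longrightarrow> j < p \<Longrightarrow> (\<lambda>\<omega>. v j (Z i \<omega>)) \<in> borel_measurable M"
  using measurable_compose[OF Z_measurable v_measurable] .

lemma V_integrable: "i < n \<Longrightarrow> j < p \<Longrightarrow> integrable M (\<lambda>\<omega>. v j (Z i \<omega>))"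
  by (rule square_integrable_imp_integrable[OF V_measurable v_square_integrable])

lemma VV_integrable: "i < n \<Longrightarrow> j < p \<Longrightarrow> k < p \<Longrightarrow> integrable M (\<lambda>\<omega>. v j (Z i \<omega>) * v k (Z i \<omega>))"
  by (intro integrable_mult_of_squares V_measurable v_square_integrable)

lemma
  assumes "i < n" "l < n" "j < p" "k < p"
  shows V_cross_integrable: "integrable M (\<lambda>\<omega>. v j (Z i \<omega>) * v k (Z l \<omega>))"
    and V_cross_moment: "expectation (\<lambda>\<omega>. v j (Z i \<omega>) * v k (Z l \<omega>)) = (if i = l then S j k else 0)"
proof -
  show "integrable M (\<lambda>\<omega>. v j (Z i \<omega>) * v k (Z l \<omega>))"
    using assms by (intro integrable_mult_of_squares V_measurable v_square_integrable)
  show "expectation (\<lambda>\<omega>. v j (Z i \<omega>) * v k (Z l \<omega>)) = (if i = l then S j k else 0)"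
  proof (cases "i = l")
    case False
    have "expectation (\<lambda>\<omega>. prod_list (map (\<lambda>(k, g). g (Z k \<omega>)) [(i, v j), (l, v k)])) =
      (\<Prod>q\<in>{..<n}. expectation (\<lambda>\<omega>. prod_list (map (\<lambda>(k, g). if k = q then g (Z q \<omega>) else 1)
         [(i, v j), (l, v k)])))"
    proof (rule expectation_indep_prod_list[OF indep])
      fix q assume "q \<in> {..<n}"
      then show "integrable M (\<lambda>\<omega>. prod_list (map (\<lambda>(k, g). if k = q then g (Z q \<omega>) else 1)
          [(i, v j), (l, v k)]))"
        using assms False by (cases "q = i"; cases "q = l") (auto simp: V_integrable)
    qed (use assms in \<open>auto simp: v_measurable\<close>)
    also have "\<dots> = 0"
    proof (rule prod_zero)
      show "\<exists>q\<in>{..<n}. expectation (\<lambda>\<omega>. prod_list (map (\<lambda>(k, g). if k = q then g (Z q \<omega>) else 1)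
         [(i, v j), (l, v k)])) = 0"
        using assms False by (intro bexI[of _ i]) (auto simp: v_mean)
    qed simp
    finally show ?thesis using False by simp
  qed (use assms v_second_moment in simp)
qed

text \<open>
  The mixed moment of \<open>V\<^sub>a\<^sub>j V\<^sub>b\<^sub>j\<close> and \<open>V\<^sub>c\<^sub>k V\<^sub>d\<^sub>k\<close>, where \<open>V\<^sub>i\<^sub>j\<close> stands for \<open>v j (Z i)\<close>.
  Each observation contributes at most two factors, as \<open>a < b\<close> and \<open>c < d\<close>, so second moments
  suffice for integrability. For equal pairs the factors of \<open>a\<close> and of \<open>b\<close> have mean \<open>S j k\<close> each.
\<close>

lemma
  assumes less: "a < n" "b < n" "c < n" "d < n" "j < p" "k < p" and ne: "a < b" "c < d"
  shows V_quad_integrable: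
      "integrable M (\<lambda>\<omega>. (v j (Z a \<omega>) * v j (Z b \<omega>)) * (v k (Z c \<omega>) * v k (Z d \<omega>)))"
    and V_quad_moment:
      "expectation (\<lambda>\<omega>. (v j (Z a \<omega>) * v j (Z b \<omega>)) * (v k (Z c \<omega>) * v k (Z d \<omega>))) =
         (if (a, b) = (c, d) then (S j k)\<^sup>2 else 0)"
proof -
  let ?L = "[(a, v j), (b, v j), (c, v k), (d, v k)]"
  let ?f = "\<lambda>q \<omega>. prod_list (map (\<lambda>(k, g). if k = q then g (Z q \<omega>) else 1) ?L)"
  have int: "integrable M (?f q)" if "q \<in> {..<n}" for q
  proof -
    have "q < n" using that by simp
    then show ?thesis
      using less ne
      by (cases "q = a"; cases "q = b"; cases "q = c"; cases "q = d")
         (auto simp: V_integrable VV_integrable)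
  qed
  have meas: "k' \<in> {..<n} \<and> g \<in> borel_measurable N" if "(k', g) \<in> set ?L" for k' g
    using that less by (auto simp: v_measurable)
  have assoc: "(v j (Z a \<omega>) * v j (Z b \<omega>)) * (v k (Z c \<omega>) * v k (Z d \<omega>)) =
      prod_list (map (\<lambda>(k, g). g (Z k \<omega>)) ?L)" for \<omega>
    by (simp add: mult.assoc)
  show "integrable M (\<lambda>\<omega>. (v j (Z a \<omega>) * v j (Z b \<omega>)) * (v k (Z c \<omega>) * v k (Z d \<omega>)))"
    unfolding assoc by (rule integrable_indep_prod_list[OF indep _ meas int]) auto
  have eq: "expectation (\<lambda>\<omega>. (v j (Z a \<omega>) * v j (Z b \<omega>)) * (v k (Z c \<omega>) * v k (Z d \<omega>))) =
      (\<Prod>q<n. expectation (?f q))"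
    unfolding assoc by (rule expectation_indep_prod_list[OF indep _ meas int]) auto
  show "expectation (\<lambda>\<omega>. (v j (Z a \<omega>) * v j (Z b \<omega>)) * (v k (Z c \<omega>) * v k (Z d \<omega>))) =
         (if (a, b) = (c, d) then (S j k)\<^sup>2 else 0)"
  proof (cases "(a, b) = (c, d)")
    case True
    have "expectation (?f q) = (if q = a then S j k else 1) * (if q = b then S j k else 1)"
      if "q < n" for q
      using True ne less that
      by (cases "q = a"; cases "q = b") (auto simp: v_second_moment prob_space)
    then have "(\<Prod>q<n. expectation (?f q)) =
        (\<Prod>q<n. (if q = a then S j k else 1) * (if q = b then S j k else 1))"
      by (intro prod.cong) auto
    also have "\<dots> = (S j k)\<^sup>2"
      using less by (simp add: prod.distrib power2_eq_square)
    finally show ?thesis using True eq by simp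
  next
    case False
    \<comment> \<open>Two distinct increasing pairs do not have the same entries, so \<open>a\<close> or \<open>b\<close> occurs just once.\<close>
    then have "a \<notin> {c, d} \<or> b \<notin> {c, d}" using ne by auto
    then have "expectation (?f a) = 0 \<or> expectation (?f b) = 0"
      using ne less by (auto simp: v_mean)
    then have "\<exists>q\<in>{..<n}. expectation (?f q) = 0"
      using less by blast
    then have "(\<Prod>q<n. expectation (?f q)) = 0" by (intro prod_zero) auto
    then show ?thesis using False eq by auto
  qed
qed

text \<open>
  The inner products of distinct pairs of centered vectors are uncorrelated, although they
  may share an observation; this degeneracy is what makes the variance of their average of order
  \<open>1 / n\<^sup>2\<close> instead of \<open>1 / n\<close>.
\<close>

lemma
  assumes less: "a < n" "b < n" "c < n" "d < n" and ne: "a < b" "c < d"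
  shows inner_mult_integrable: "integrable M (\<lambda>\<omega>. inner a b \<omega> * inner c d \<omega>)"
    and inner_mult_moment: "expectation (\<lambda>\<omega>. inner a b \<omega> * inner c d \<omega>) =
      (if (a, b) = (c, d) then \<Sum>j<p. \<Sum>k<p. (S j k)\<^sup>2 else 0)"
proof -
  have int: "integrable M (\<lambda>\<omega>. (v j (Z a \<omega>) * v j (Z b \<omega>)) * (v k (Z c \<omega>) * v k (Z d \<omega>)))"
    if "j \<in> {..<p}" "k \<in> {..<p}" for j k
    using that assms by (intro V_quad_integrable) auto
  show "integrable M (\<lambda>\<omega>. inner a b \<omega> * inner c d \<omega>)"
    unfolding inner_def sum_product by (intro Bochner_Integration.integrable_sum int)
  have "expectation (\<lambda>\<omega>. inner a b \<omega> * inner c d \<omega>) = (\<Sum>j<p. \<Sum>k<p.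
      expectation (\<lambda>\<omega>. (v j (Z a \<omega>) * v j (Z b \<omega>)) * (v k (Z c \<omega>) * v k (Z d \<omega>))))"
    unfolding inner_def sum_product
    by (intro integral_double_sum int)
  also have "\<dots> = (\<Sum>j<p. \<Sum>k<p. if (a, b) = (c, d) then (S j k)\<^sup>2 else 0)"
    using assms by (intro sum.cong refl V_quad_moment) auto
  finally show "expectation (\<lambda>\<omega>. inner a b \<omega> * inner c d \<omega>) =
      (if (a, b) = (c, d) then \<Sum>j<p. \<Sum>k<p. (S j k)\<^sup>2 else 0)"
    by auto
qed

lemma
  shows inner_sum_square_integrable:
      "integrable M (\<lambda>\<omega>. (\<Sum>b<n. \<Sum>a<b. inner a b \<omega>)\<^sup>2)"
    and inner_sum_second_moment:
      "expectation (\<lambda>\<omega>. (\<Sum>b<n. \<Sum>a<b. inner a b \<omega>)\<^sup>2) =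
        real (n choose 2) * (\<Sum>j<p. \<Sum>k<p. (S j k)\<^sup>2)"
proof -
  let ?P = "Sigma {..<n} (\<lambda>b. {..<b})"
  have pairs: "(\<Sum>b<n. \<Sum>a<b. inner a b \<omega>) = (\<Sum>x\<in>?P. inner (snd x) (fst x) \<omega>)" for \<omega>
    by (simp add: sum.Sigma case_prod_unfold)
  have card: "card ?P = n choose 2"
  proof -
    have "card ?P = (\<Sum>b<n. b)" by simp
    also have "\<dots> = n choose 2"
      by (induction n) (auto simp: numeral_2_eq_2)
    finally show ?thesis .
  qed
  have int: "integrable M (\<lambda>\<omega>. inner (snd x) (fst x) \<omega> * inner (snd y) (fst y) \<omega>)"
    if "x \<in> ?P" "y \<in> ?P" for x y
    using that by (intro inner_mult_integrable) auto
  have moment: "expectation (\<lambda>\<omega>. inner (snd x) (fst x) \<omega> * inner (snd y) (fst y) \<omega>) =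
      (if x = y then \<Sum>j<p. \<Sum>k<p. (S j k)\<^sup>2 else 0)"
    if "x \<in> ?P" "y \<in> ?P" for x y
    using that by (subst inner_mult_moment) (auto simp: prod_eq_iff)
  show "integrable M (\<lambda>\<omega>. (\<Sum>b<n. \<Sum>a<b. inner a b \<omega>)\<^sup>2)"
    unfolding pairs by (intro integrable_orthogonal_sum int) (auto simp: moment)
  have "expectation (\<lambda>\<omega>. (\<Sum>b<n. \<Sum>a<b. inner a b \<omega>)\<^sup>2) =
      (\<Sum>x\<in>?P. expectation (\<lambda>\<omega>. (inner (snd x) (fst x) \<omega>)\<^sup>2))"
    unfolding pairs by (intro integral_orthogonal_sum int) (auto simp: moment)
  also have "\<dots> = (\<Sum>x\<in>?P. \<Sum>j<p. \<Sum>k<p. (S j k)\<^sup>2)"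
    using moment by (intro sum.cong refl) (metis (no_types, lifting) power2_eq_square Bochner_Integration.integral_cong)
  also have "\<dots> = real (n choose 2) * (\<Sum>j<p. \<Sum>k<p. (S j k)\<^sup>2)"
    by (simp only: sum_constant card)
  finally show "expectation (\<lambda>\<omega>. (\<Sum>b<n. \<Sum>a<b. inner a b \<omega>)\<^sup>2) =
        real (n choose 2) * (\<Sum>j<p. \<Sum>k<p. (S j k)\<^sup>2)" .
qed

lemma
  shows lin_sum_square_integrable: "integrable M (\<lambda>\<omega>. (\<Sum>i<n. lin c i \<omega>)\<^sup>2)"
    and lin_sum_second_moment:
      "expectation (\<lambda>\<omega>. (\<Sum>i<n. lin c i \<omega>)\<^sup>2) = real n * (\<Sum>j<p. \<Sum>k<p. c j * c k * S j k)"
proof -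
  have expand: "lin c i \<omega> * lin c l \<omega> = (\<Sum>j<p. \<Sum>k<p. c j * c k * (v j (Z i \<omega>) * v k (Z l \<omega>)))" for i l \<omega>
    unfolding lin_def sum_product by (simp add: mult_ac)
  have int0: "integrable M (\<lambda>\<omega>. c j * c k * (v j (Z i \<omega>) * v k (Z l \<omega>)))"
    if "i < n" "l < n" "j \<in> {..<p}" "k \<in> {..<p}" for i l j k
    using that by (intro integrable_mult_right V_cross_integrable) auto
  have int: "integrable M (\<lambda>\<omega>. lin c i \<omega> * lin c l \<omega>)" if "i < n" "l < n" for i l
    unfolding expand using that by (intro Bochner_Integration.integrable_sum int0)
  have moment: "expectation (\<lambda>\<omega>. lin c i \<omega> * lin c l \<omega>) =
      (if i = l then \<Sum>j<p. \<Sum>k<p. c j * c k * S j k else 0)" if "i < n" "l < n" for i l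
  proof -
    have "expectation (\<lambda>\<omega>. lin c i \<omega> * lin c l \<omega>) = (\<Sum>j<p. \<Sum>k<p.
        expectation (\<lambda>\<omega>. c j * c k * (v j (Z i \<omega>) * v k (Z l \<omega>))))"
      unfolding expand using that
      by (intro integral_double_sum int0)
    also have "\<dots> = (\<Sum>j<p. \<Sum>k<p. c j * c k * (if i = l then S j k else 0))"
      using that by (intro sum.cong refl) (simp add: V_cross_moment)
    finally show ?thesis by auto
  qed
  show "integrable M (\<lambda>\<omega>. (\<Sum>i<n. lin c i \<omega>)\<^sup>2)"
    by (intro integrable_orthogonal_sum int) (auto simp: moment)
  have "expectation (\<lambda>\<omega>. (\<Sum>i<n. lin c i \<omega>)\<^sup>2) = (\<Sum>i<n. expectation (\<lambda>\<omega>. (lin c i \<omega>)\<^sup>2))"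
    by (intro integral_orthogonal_sum int) (auto simp: moment)
  also have "\<dots> = (\<Sum>i<n. \<Sum>j<p. \<Sum>k<p. c j * c k * S j k)"
    by (intro sum.cong refl) (simp add: moment power2_eq_square)
  finally show "expectation (\<lambda>\<omega>. (\<Sum>i<n. lin c i \<omega>)\<^sup>2) = real n * (\<Sum>j<p. \<Sum>k<p. c j * c k * S j k)"
    by simp
qed

end

section \<open>Moments in the linear model\<close>

context linear_model
begin

definition obs :: "nat \<Rightarrow> 'a \<Rightarrow> (nat \<Rightarrow> real) \<times> real" where
  "obs i \<omega> = (design_row p X i \<omega>, Y i \<omega>)"

abbreviation row_algebra :: "nat \<Rightarrow> 'a measure" where
  "row_algebra i \<equiv> sigma_gen M (borel_vec p) (design_row p X i)"

abbreviation A :: "nat \<Rightarrow> nat \<Rightarrow> real" where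
  "A \<equiv> A_mat M X Y"

abbreviation \<tau>2 :: real where
  "\<tau>2 \<equiv> signal_level p \<beta>"

lemma obs_measurable [measurable]: "i < n \<Longrightarrow> obs i \<in> M \<rightarrow>\<^sub>M borel_vec p \<Otimes>\<^sub>M borel"
  using indep unfolding obs_def[abs_def] indep_vars_def by simp

lemma design_row_measurable: "i < n \<Longrightarrow> design_row p X i \<in> M \<rightarrow>\<^sub>M borel_vec p"
  using measurable_compose[OF obs_measurable measurable_fst] by (simp add: obs_def)

lemma Y_measurable [measurable]: "i < n \<Longrightarrow> Y i \<in> borel_measurable M"
  using measurable_compose[OF obs_measurable measurable_snd] by (simp add: obs_def)

lemma X_row_measurable:
  assumes "i < n" "j < p"
  shows "X i j \<in> borel_measurable (row_algebra i)"
proof -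
  have "design_row p X i \<in> row_algebra i \<rightarrow>\<^sub>M borel_vec p"
    unfolding sigma_gen_def using measurable_space[OF design_row_measurable[OF assms(1)]]
    by (intro measurable_vimage_algebra1) auto
  from measurable_compose[OF this measurable_component_singleton[of j]]
  show ?thesis using assms by (simp add: design_row_def)
qed

lemma subalgebra_row: "i < n \<Longrightarrow> subalgebra M (row_algebra i)"
  unfolding subalgebra_def sigma_gen_def
  by (auto intro: sets_image_in_sets[OF refl design_row_measurable, THEN subsetD])

lemma row_measurable_imp_measurable:
  "i < n \<Longrightarrow> f \<in> borel_measurable (row_algebra i) \<Longrightarrow> f \<in> borel_measurable M"
  by (rule measurable_from_subalg[OF subalgebra_row])

lemma X_measurable [measurable]: "i < n \<Longrightarrow> j < p \<Longrightarrow> X i j \<in> borel_measurable M"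
  by (rule row_measurable_imp_measurable[OF _ X_row_measurable])

lemma noise_measurable [measurable]:
  assumes "i < n"
  shows "\<epsilon> i \<in> borel_measurable M"
proof -
  have "(\<lambda>\<omega>. Y i \<omega> - (\<Sum>j<p. \<beta> j * X i j \<omega>)) \<in> borel_measurable M"
    using assms by measurable
  moreover have "Y i \<omega> - (\<Sum>j<p. \<beta> j * X i j \<omega>) = \<epsilon> i \<omega>" if "\<omega> \<in> space M" for \<omega>
    using linear[OF assms that] by simp
  ultimately show ?thesis by (subst (asm) measurable_cong) auto
qed

lemma cond_exp_row_locale: "i < n \<Longrightarrow> finite_measure_subalgebra M (row_algebra i)"
  using subalgebra_row by unfold_locales

text \<open>
  Conditionally on its row, the noise has mean zero, so it is orthogonal to every function of the row.
\<close>

lemma noise_orthogonal: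
  assumes i: "i < n" and f: "f \<in> borel_measurable (row_algebra i)"
    and int: "integrable M (\<lambda>\<omega>. f \<omega> * \<epsilon> i \<omega>)"
  shows "expectation (\<lambda>\<omega>. f \<omega> * \<epsilon> i \<omega>) = 0"
proof -
  interpret R: finite_measure_subalgebra M "row_algebra i"
    by (rule cond_exp_row_locale[OF i])
  note [measurable] = f row_measurable_imp_measurable[OF i f] noise_measurable[OF i]
  have "expectation (\<lambda>\<omega>. f \<omega> * \<epsilon> i \<omega>) =
      expectation (\<lambda>\<omega>. f \<omega> * real_cond_exp M (row_algebra i) (\<epsilon> i) \<omega>)"
    using R.real_cond_exp_intg(2)[OF int] by simp
  also have "\<dots> = expectation (\<lambda>\<omega>. 0)"
    using noise_mean[OF i] by (intro integral_cong_AE) auto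
  finally show ?thesis by simp
qed

lemma noise_square_moment:
  assumes i: "i < n" and f: "f \<in> borel_measurable (row_algebra i)"
    and int: "integrable M (\<lambda>\<omega>. f \<omega> * (\<epsilon> i \<omega>)\<^sup>2)"
  shows "expectation (\<lambda>\<omega>. f \<omega> * (\<epsilon> i \<omega>)\<^sup>2) = \<sigma>\<^sup>2 * expectation f"
proof -
  interpret R: finite_measure_subalgebra M "row_algebra i"
    by (rule cond_exp_row_locale[OF i])
  note [measurable] = f row_measurable_imp_measurable[OF i f] noise_measurable[OF i]
  have "expectation (\<lambda>\<omega>. f \<omega> * (\<epsilon> i \<omega>)\<^sup>2) =
      expectation (\<lambda>\<omega>. f \<omega> * real_cond_exp M (row_algebra i) (\<lambda>\<omega>. (\<epsilon> i \<omega>)\<^sup>2) \<omega>)"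
    using R.real_cond_exp_intg(2)[OF int] by simp
  also have "\<dots> = expectation (\<lambda>\<omega>. \<sigma>\<^sup>2 * f \<omega>)"
    using noise_var[OF i] by (intro integral_cong_AE) auto
  finally show ?thesis by simp
qed

text \<open>
  The assumption on the conditional variance concerns the real-valued conditional expectation, whose
  product rule needs the product to be integrable beforehand. The extended nonnegative version does not,
  and so serves to prove that integrability.
\<close>

lemma nn_cond_exp_noise_square:
  assumes i: "i < n"
  shows "AE \<omega> in M. nn_cond_exp M (row_algebra i) (\<lambda>\<omega>. ennreal ((\<epsilon> i \<omega>)\<^sup>2)) \<omega> = ennreal (\<sigma>\<^sup>2)"
proof -
  interpret R: finite_measure_subalgebra M "row_algebra i"
    by (rule cond_exp_row_locale[OF i])
  note [measurable] = noise_measurable[OF i]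
  let ?c = "nn_cond_exp M (row_algebra i) (\<lambda>\<omega>. ennreal ((\<epsilon> i \<omega>)\<^sup>2))"
  have c_meas: "?c \<in> borel_measurable M"
    by simp
  have "(\<integral>\<^sup>+\<omega>. ?c \<omega> \<partial>M) = (\<integral>\<^sup>+\<omega>. ennreal ((\<epsilon> i \<omega>)\<^sup>2) \<partial>M)"
    using R.nn_cond_exp_intg[of "\<lambda>_. 1" "\<lambda>\<omega>. ennreal ((\<epsilon> i \<omega>)\<^sup>2)"] by simp
  also have "\<dots> < \<infinity>"
    using noise_square_integrable[OF i] by (simp add: integrable_iff_bounded)
  finally have fin: "AE \<omega> in M. ?c \<omega> \<noteq> \<infinity>"
    by (intro nn_integral_PInf_AE c_meas) simp
  have "AE \<omega> in M. 0 = nn_cond_exp M (row_algebra i) (\<lambda>\<omega>. 0) \<omega>"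
    by (rule R.nn_cond_exp_F_meas) simp
  then have "AE \<omega> in M. real_cond_exp M (row_algebra i) (\<lambda>\<omega>. (\<epsilon> i \<omega>)\<^sup>2) \<omega> = enn2real (?c \<omega>)"
    unfolding real_cond_exp_def by (auto simp: ennreal_neg)
  then show ?thesis
    using noise_var[OF i] fin
  proof eventually_elim
    case (elim \<omega>)
    then have "enn2real (?c \<omega>) = \<sigma>\<^sup>2" by simp
    with elim(3) show ?case by (metis ennreal_enn2real_if infinity_ennreal_def)
  qed
qed

lemma row_mult_noise_square_integrable:
  assumes i: "i < n" and f: "f \<in> borel_measurable (row_algebra i)"
    and int: "integrable M (\<lambda>\<omega>. (f \<omega>)\<^sup>2)"
  shows "integrable M (\<lambda>\<omega>. (f \<omega> * \<epsilon> i \<omega>)\<^sup>2)"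
proof -
  interpret R: finite_measure_subalgebra M "row_algebra i"
    by (rule cond_exp_row_locale[OF i])
  note [measurable] = f row_measurable_imp_measurable[OF i f] noise_measurable[OF i]
  have "(\<integral>\<^sup>+\<omega>. ennreal ((f \<omega> * \<epsilon> i \<omega>)\<^sup>2) \<partial>M) = (\<integral>\<^sup>+\<omega>. ennreal ((f \<omega>)\<^sup>2) * ennreal ((\<epsilon> i \<omega>)\<^sup>2) \<partial>M)"
    by (simp add: power_mult_distrib ennreal_mult)
  also have "\<dots> = (\<integral>\<^sup>+\<omega>. ennreal ((f \<omega>)\<^sup>2) *
      nn_cond_exp M (row_algebra i) (\<lambda>\<omega>. ennreal ((\<epsilon> i \<omega>)\<^sup>2)) \<omega> \<partial>M)"
    by (rule R.nn_cond_exp_intg[symmetric]) auto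
  also have "\<dots> = (\<integral>\<^sup>+\<omega>. ennreal ((f \<omega>)\<^sup>2) * ennreal (\<sigma>\<^sup>2) \<partial>M)"
    using nn_cond_exp_noise_square[OF i] by (intro nn_integral_cong_AE) auto
  also have "\<dots> = (\<integral>\<^sup>+\<omega>. ennreal ((f \<omega>)\<^sup>2) \<partial>M) * ennreal (\<sigma>\<^sup>2)"
    by (rule nn_integral_multc) simp
  also have "\<dots> < \<infinity>"
    using int by (auto simp: integrable_iff_bounded ennreal_mult_less_top)
  finally show ?thesis
    by (simp add: integrable_iff_bounded)
qed

lemma XX_integrable: "i < n \<Longrightarrow> j < p \<Longrightarrow> k < p \<Longrightarrow> integrable M (\<lambda>\<omega>. X i j \<omega> * X i k \<omega>)"
  by (intro integrable_mult_of_squares X_measurable X_square_integrable)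

lemma XX_moment:
  "i < n \<Longrightarrow> j < p \<Longrightarrow> k < p \<Longrightarrow> expectation (\<lambda>\<omega>. X i j \<omega> * X i k \<omega>) = (if j = k then 1 else 0)"
  using X_cov[of i j k] X_mean[of i j] X_mean[of i k] by (simp add: cov_def)

lemma W_decomp:
  assumes "i < n" "\<omega> \<in> space M"
  shows "W X Y i j \<omega> = (\<Sum>k<p. \<beta> k * (X i j \<omega> * X i k \<omega>)) + X i j \<omega> * \<epsilon> i \<omega>"
  using linear[OF assms] by (simp add: W_def algebra_simps sum_distrib_left)

text \<open>
  Since the predictors are uncorrelated with unit variance, \<open>X\<^sub>i\<^sub>j \<beta>\<^sup>T X\<^sub>i\<close> has mean \<open>\<beta>\<^sub>j\<close>; the noise
  contributes nothing.
\<close>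

lemma W_mean:
  assumes i: "i < n" and j: "j < p"
  shows "expectation (W X Y i j) = \<beta> j"
proof -
  have noise: "integrable M (\<lambda>\<omega>. X i j \<omega> * \<epsilon> i \<omega>)"
    using i j by (intro integrable_mult_of_squares X_measurable noise_measurable
      X_square_integrable noise_square_integrable)
  have signal: "integrable M (\<lambda>\<omega>. \<beta> k * (X i j \<omega> * X i k \<omega>))" if "k \<in> {..<p}" for k
    using that i j XX_integrable by simp
  have "expectation (W X Y i j) =
      expectation (\<lambda>\<omega>. (\<Sum>k<p. \<beta> k * (X i j \<omega> * X i k \<omega>)) + X i j \<omega> * \<epsilon> i \<omega>)"
    using W_decomp[OF i] by (intro Bochner_Integration.integral_cong) auto
  also have "\<dots> = (\<Sum>k<p. expectation (\<lambda>\<omega>. \<beta> k * (X i j \<omega> * X i k \<omega>)))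
      + expectation (\<lambda>\<omega>. X i j \<omega> * \<epsilon> i \<omega>)"
    using noise signal
    by (subst Bochner_Integration.integral_add)
       (auto intro!: Bochner_Integration.integrable_sum Bochner_Integration.integral_sum)
  also have "\<dots> = (\<Sum>k<p. if j = k then \<beta> k else 0)"
    using i j noise_orthogonal[OF i X_row_measurable noise]
    by (simp add: XX_moment if_distrib cong: if_cong)
  finally show ?thesis using j by simp
qed

lemma
  assumes g: "g \<in> borel_measurable (borel_vec p \<Otimes>\<^sub>M borel)" and i: "i < n"
  shows integrable_obs_iff: "integrable M (\<lambda>\<omega>. g (obs i \<omega>)) \<longleftrightarrow> integrable M (\<lambda>\<omega>. g (obs 0 \<omega>) :: real)"
    and expectation_obs: "expectation (\<lambda>\<omega>. g (obs i \<omega>)) = expectation (\<lambda>\<omega>. g (obs 0 \<omega>))"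
proof -
  have 0: "0 < n" using i by simp
  have D: "distr M (borel_vec p \<Otimes>\<^sub>M borel) (obs i) = distr M (borel_vec p \<Otimes>\<^sub>M borel) (obs 0)"
    using ident_distr[OF i 0] unfolding obs_def[abs_def] by simp
  show "integrable M (\<lambda>\<omega>. g (obs i \<omega>)) \<longleftrightarrow> integrable M (\<lambda>\<omega>. g (obs 0 \<omega>))"
    using integrable_distr_eq[OF obs_measurable[OF i] g] integrable_distr_eq[OF obs_measurable[OF 0] g]
    by (simp add: D)
  show "expectation (\<lambda>\<omega>. g (obs i \<omega>)) = expectation (\<lambda>\<omega>. g (obs 0 \<omega>))"
    using integral_distr[OF obs_measurable[OF i] g] integral_distr[OF obs_measurable[OF 0] g]
    by (simp add: D)
qed

text \<open>
  The coordinate \<open>W\<^sub>i\<^sub>j\<close> as a function of the observation, so that independence and equality in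
  distribution pass from the observations to the vectors \<open>W\<^sub>i\<close>.
\<close>

definition wfun :: "nat \<Rightarrow> (nat \<Rightarrow> real) \<times> real \<Rightarrow> real" where
  "wfun j z = fst z j * snd z"

lemma wfun_measurable [measurable]: "j < p \<Longrightarrow> wfun j \<in> borel_measurable (borel_vec p \<Otimes>\<^sub>M borel)"
  unfolding wfun_def[abs_def]
  by (intro borel_measurable_times measurable_snd
      measurable_compose[OF measurable_fst measurable_component_singleton]) auto

lemma wfun_obs: "j < p \<Longrightarrow> wfun j (obs i \<omega>) = W X Y i j \<omega>"
  by (simp add: wfun_def obs_def design_row_def W_def)

lemma WW_integrable:
  assumes "A_exists M p X Y" "i < n" "j < p" "k < p"
  shows "integrable M (\<lambda>\<omega>. W X Y i j \<omega> * W X Y i k \<omega>)"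
  using assms integrable_obs_iff[of "\<lambda>z. wfun j z * wfun k z" i]
  by (simp add: A_exists_def wfun_obs)

lemma WW_moment:
  assumes "i < n" "j < p" "k < p"
  shows "expectation (\<lambda>\<omega>. W X Y i j \<omega> * W X Y i k \<omega>) = A j k"
  using assms expectation_obs[of "\<lambda>z. wfun j z * wfun k z" i]
  by (simp add: A_mat_def wfun_obs)

lemma W_measurable [measurable]: "i < n \<Longrightarrow> j < p \<Longrightarrow> W X Y i j \<in> borel_measurable M"
  unfolding W_def[abs_def] by simp

lemma W_integrable:
  assumes "A_exists M p X Y" "i < n" "j < p"
  shows "integrable M (W X Y i j)"
  using WW_integrable[OF assms(1,2,3,3)] assms
  by (intro square_integrable_imp_integrable[OF W_measurable]) (auto simp: power2_eq_square)

lemma centered_sample_W: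
  assumes ex: "A_exists M p X Y"
  shows "centered_sample M n p (borel_vec p \<Otimes>\<^sub>M borel) obs (\<lambda>j z. wfun j z - \<beta> j)
    (\<lambda>j k. A j k - \<beta> j * \<beta> k)"
proof
  show "indep_vars (\<lambda>_. borel_vec p \<Otimes>\<^sub>M borel) obs {..<n}"
    using indep unfolding obs_def[abs_def] .
  show "(\<lambda>z. wfun j z - \<beta> j) \<in> borel_measurable (borel_vec p \<Otimes>\<^sub>M borel)" if "j < p" for j
    using that by simp
next
  fix i j assume [simp]: "i < n" "j < p"
  note [simp] = W_integrable[OF ex] WW_integrable[OF ex]
  show "expectation (\<lambda>\<omega>. wfun j (obs i \<omega>) - \<beta> j) = 0"
    by (simp add: wfun_obs W_mean prob_space)
  have expand: "(wfun j (obs i \<omega>) - \<beta> j) * (wfun k (obs i \<omega>) - \<beta> k) =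
      W X Y i j \<omega> * W X Y i k \<omega> - \<beta> k * W X Y i j \<omega> - \<beta> j * W X Y i k \<omega> + \<beta> j * \<beta> k"
    if "k < p" for k \<omega>
    using that by (simp add: wfun_obs algebra_simps)
  show "integrable M (\<lambda>\<omega>. (wfun j (obs i \<omega>) - \<beta> j)\<^sup>2)"
    by (simp add: expand power2_eq_square)
  show "expectation (\<lambda>\<omega>. (wfun j (obs i \<omega>) - \<beta> j) * (wfun k (obs i \<omega>) - \<beta> k)) = A j k - \<beta> j * \<beta> k"
    if "k < p" for k
    using that by (simp add: expand WW_moment W_mean prob_space)
qed

lemma naive_estimator_measurable: "naive_estimator n p X Y \<in> borel_measurable M"
proof -
  have "(\<lambda>\<omega>. \<Sum>b<n. \<Sum>a<b. \<Sum>j<p. W X Y a j \<omega> * W X Y b j \<omega>) \<in> borel_measurable M"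
    by (intro borel_measurable_sum borel_measurable_times W_measurable) auto
  then show ?thesis
    unfolding naive_estimator_def[abs_def] by simp
qed

end

section \<open>The error of the naive estimator\<close>

lemma signal_level_square: "(\<Sum>j<p. \<Sum>k<p. (\<beta> j * \<beta> k)\<^sup>2) = (signal_level p \<beta>)\<^sup>2"
  by (simp add: signal_level_def power2_eq_square[of "sum _ _"] sum_product power_mult_distrib)

lemma sum_pairs_add:
  fixes g :: "nat \<Rightarrow> real"
  shows "(\<Sum>b<n. \<Sum>a<b. g a + g b) = (real n - 1) * (\<Sum>i<n. g i)"
  by (induction n) (simp_all add: sum.distrib algebra_simps)

lemma real_choose_two: "real (n choose 2) = real n * (real n - 1) / 2"
  by (induction n) (simp_all add: numeral_2_eq_2 field_simps)

context linear_model
begin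

text \<open>
  With \<open>V\<^sub>i = W\<^sub>i - \<beta>\<close>, each inner product splits as
  \<open>W\<^sub>a\<^sup>T W\<^sub>b = V\<^sub>a\<^sup>T V\<^sub>b + \<beta>\<^sup>T V\<^sub>a + \<beta>\<^sup>T V\<^sub>b + \<tau>\<^sup>2\<close>, so the error is the average of the
  \<open>V\<^sub>a\<^sup>T V\<^sub>b\<close> over pairs plus \<open>2 / n\<close> times the sum of the \<open>\<beta>\<^sup>T V\<^sub>i\<close>. Both parts are sums of uncorrelated
  terms. The bound replaces the covariance matrix \<open>A - \<beta> \<beta>\<^sup>T\<close> of \<open>V\<^sub>i\<close> by \<open>A\<close>, at the price of \<open>\<tau>\<^sup>4\<close>
  in the first term.
\<close>

lemma naive_estimator_error_second_moment:
  assumes ex: "A_exists M p X Y" and n2: "2 \<le> n"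
  shows "integrable M (\<lambda>\<omega>. (naive_estimator n p X Y \<omega> - \<tau>2)\<^sup>2)" (is ?int)
    and "expectation (\<lambda>\<omega>. (naive_estimator n p X Y \<omega> - \<tau>2)\<^sup>2) \<le>
      16 * ((frobenius_norm p A)\<^sup>2 + \<tau>2\<^sup>2) / (real n)\<^sup>2
      + 8 * (\<Sum>j<p. \<Sum>k<p. \<beta> j * \<beta> k * A j k) / real n" (is ?bound)
proof -
  define N where "N = real (n choose 2)"
  define S where "S j k = A j k - \<beta> j * \<beta> k" for j k
  interpret C: centered_sample M n p "borel_vec p \<Otimes>\<^sub>M borel" obs "\<lambda>j z. wfun j z - \<beta> j" S
    unfolding S_def by (rule centered_sample_W[OF ex])
  define D where "D \<omega> = (\<Sum>b<n. \<Sum>a<b. C.inner a b \<omega>)" for \<omega>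
  define L where "L \<omega> = (\<Sum>i<n. C.lin \<beta> i \<omega>)" for \<omega>
  have N: "N = real n * (real n - 1) / 2" "N > 0" "4 * N \<ge> (real n)\<^sup>2"
  proof -
    show N_eq: "N = real n * (real n - 1) / 2" by (simp add: N_def real_choose_two)
    show "N > 0" using n2 by (simp add: N_def)
    have "0 \<le> real n * (real n - 2)" using n2 by simp
    then show "4 * N \<ge> (real n)\<^sup>2" by (simp add: N_eq power2_eq_square algebra_simps)
  qed
  have pair: "(\<Sum>j<p. W X Y a j \<omega> * W X Y b j \<omega>) = C.inner a b \<omega> + (C.lin \<beta> a \<omega> + C.lin \<beta> b \<omega>) + \<tau>2" for a b \<omega>
    unfolding C.inner_def C.lin_def signal_level_def sum.distrib[symmetric]
    by (intro sum.cong refl) (simp add: wfun_obs power2_eq_square algebra_simps)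
  have "(\<Sum>b<n. \<Sum>a<b. \<tau>2) = N * \<tau>2"
  proof -
    have "(\<Sum>b<n. \<Sum>a<b. \<tau>2) = (\<Sum>b<n. real b) * \<tau>2"
      by (simp add: sum_distrib_right)
    also have "(\<Sum>b<n. real b) = N"
      unfolding N_def real_choose_two by (induction n) (simp_all add: field_simps)
    finally show ?thesis .
  qed
  then have "naive_estimator n p X Y \<omega> = (D \<omega> + (real n - 1) * L \<omega> + N * \<tau>2) / N" for \<omega>
    unfolding naive_estimator_def pair N_def[symmetric] D_def L_def sum_pairs_add[symmetric]
    by (simp only: sum.distrib)
  then have "naive_estimator n p X Y \<omega> - \<tau>2 = D \<omega> / N + (real n - 1) / N * L \<omega>" for \<omega>
    using N(2) by (simp add: add_divide_distrib)
  moreover have "(real n - 1) / N = 2 / real n"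
    using n2 by (simp add: N(1) divide_simps)
  ultimately have error: "naive_estimator n p X Y \<omega> - \<tau>2 = D \<omega> / N + 2 / real n * L \<omega>" for \<omega>
    by simp
  have [measurable]: "D \<in> borel_measurable M" "L \<in> borel_measurable M"
    unfolding D_def[abs_def] L_def[abs_def] C.inner_def C.lin_def
    by (intro borel_measurable_sum borel_measurable_times C.V_measurable borel_measurable_const; simp)+
  have D2: "integrable M (\<lambda>\<omega>. (D \<omega>)\<^sup>2)" "expectation (\<lambda>\<omega>. (D \<omega>)\<^sup>2) = N * (\<Sum>j<p. \<Sum>k<p. (S j k)\<^sup>2)"
    unfolding D_def N_def by (rule C.inner_sum_square_integrable C.inner_sum_second_moment)+
  have L2: "integrable M (\<lambda>\<omega>. (L \<omega>)\<^sup>2)"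
    "expectation (\<lambda>\<omega>. (L \<omega>)\<^sup>2) = real n * (\<Sum>j<p. \<Sum>k<p. \<beta> j * \<beta> k * S j k)"
    unfolding L_def by (rule C.lin_sum_square_integrable C.lin_sum_second_moment)+
  have two: "(x + y)\<^sup>2 \<le> 2 * x\<^sup>2 + 2 * y\<^sup>2" "(x - y)\<^sup>2 \<le> 2 * x\<^sup>2 + 2 * y\<^sup>2" for x y :: real
    using sum_squares_bound[of x y] sum_squares_bound[of x "- y"]
    by (simp_all add: power2_sum power2_diff)
  let ?g = "\<lambda>\<omega>. 2 / N\<^sup>2 * (D \<omega>)\<^sup>2 + 8 / (real n)\<^sup>2 * (L \<omega>)\<^sup>2"
  have dom: "(naive_estimator n p X Y \<omega> - \<tau>2)\<^sup>2 \<le> ?g \<omega>" for \<omega>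
    using two(1)[of "D \<omega> / N" "2 / real n * L \<omega>"]
    by (simp add: error power_mult_distrib power_divide)
  have g_int: "integrable M ?g"
    using D2 L2 by simp
  show int: ?int
  proof (rule Bochner_Integration.integrable_bound[OF g_int])
    show "(\<lambda>\<omega>. (naive_estimator n p X Y \<omega> - \<tau>2)\<^sup>2) \<in> borel_measurable M"
      using naive_estimator_measurable by simp
    show "AE \<omega> in M. norm ((naive_estimator n p X Y \<omega> - \<tau>2)\<^sup>2) \<le> norm (?g \<omega>)"
      using order_trans[OF dom abs_ge_self] by simp
  qed
  let ?F = "\<Sum>j<p. \<Sum>k<p. (S j k)\<^sup>2"
  let ?q = "\<Sum>j<p. \<Sum>k<p. \<beta> j * \<beta> k * S j k"
  have "?F \<le> (\<Sum>j<p. \<Sum>k<p. 2 * (A j k)\<^sup>2 + 2 * (\<beta> j * \<beta> k)\<^sup>2)"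
    unfolding S_def by (intro sum_mono two)
  also have "\<dots> = 2 * ((frobenius_norm p A)\<^sup>2 + \<tau>2\<^sup>2)"
    unfolding signal_level_square[symmetric]
    by (simp add: frobenius_norm_def sum_nonneg sum.distrib sum_distrib_left)
  finally have F: "?F \<le> 2 * ((frobenius_norm p A)\<^sup>2 + \<tau>2\<^sup>2)" .
  have "?q = (\<Sum>j<p. \<Sum>k<p. \<beta> j * \<beta> k * A j k) - \<tau>2\<^sup>2"
    unfolding signal_level_square[symmetric] by (simp add: S_def sum_subtractf right_diff_distrib power2_eq_square)
  then have q: "?q \<le> (\<Sum>j<p. \<Sum>k<p. \<beta> j * \<beta> k * A j k)" by simp
  have "expectation (\<lambda>\<omega>. (naive_estimator n p X Y \<omega> - \<tau>2)\<^sup>2) \<le> expectation ?g"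
    using dom by (intro integral_mono int g_int)
  also have "\<dots> = 2 / N\<^sup>2 * (N * ?F) + 8 / (real n)\<^sup>2 * (real n * ?q)"
    by (simp add: D2 L2)
  also have "\<dots> = 2 / N * ?F + 8 / real n * ?q"
    using N(2) n2 by (simp add: power2_eq_square)
  also have "\<dots> \<le> 8 / (real n)\<^sup>2 * ?F + 8 / real n * ?q"
  proof -
    have "2 / N \<le> 8 / (real n)\<^sup>2"
      using N n2 by (simp add: field_simps)
    then show ?thesis by (intro add_mono mult_right_mono order_refl) (auto intro!: sum_nonneg)
  qed
  also have "\<dots> \<le> 8 / (real n)\<^sup>2 * (2 * ((frobenius_norm p A)\<^sup>2 + \<tau>2\<^sup>2))
      + 8 / real n * (\<Sum>j<p. \<Sum>k<p. \<beta> j * \<beta> k * A j k)"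
    by (intro add_mono mult_left_mono F q) auto
  finally show ?bound by simp
qed

lemma quadratic_form_le_frobenius:
  "(\<Sum>j<p. \<Sum>k<p. \<beta> j * \<beta> k * B j k) \<le> \<tau>2 * frobenius_norm p B"
proof (rule power2_le_imp_le)
  let ?I = "{..<p} \<times> {..<p}"
  have "(\<Sum>j<p. \<Sum>k<p. \<beta> j * \<beta> k * B j k)\<^sup>2 = (\<Sum>x\<in>?I. (\<beta> (fst x) * \<beta> (snd x)) * B (fst x) (snd x))\<^sup>2"
    by (simp add: sum.cartesian_product case_prod_unfold)
  also have "\<dots> \<le> (\<Sum>x\<in>?I. (\<beta> (fst x) * \<beta> (snd x))\<^sup>2) * (\<Sum>x\<in>?I. (B (fst x) (snd x))\<^sup>2)"
    by (rule Cauchy_Schwarz_ineq_sum)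
  also have "(\<Sum>x\<in>?I. (\<beta> (fst x) * \<beta> (snd x))\<^sup>2) = \<tau>2\<^sup>2"
    by (simp add: signal_level_def power2_eq_square[of "sum _ _"] sum_product power_mult_distrib
        sum.cartesian_product case_prod_unfold)
  also have "(\<Sum>x\<in>?I. (B (fst x) (snd x))\<^sup>2) = (frobenius_norm p B)\<^sup>2"
    by (simp add: frobenius_norm_def sum_nonneg sum.cartesian_product case_prod_unfold)
  finally show "(\<Sum>j<p. \<Sum>k<p. \<beta> j * \<beta> k * B j k)\<^sup>2 \<le> (\<tau>2 * frobenius_norm p B)\<^sup>2"
    by (simp add: power_mult_distrib)
  show "0 \<le> \<tau>2 * frobenius_norm p B"
    by (simp add: signal_level_def frobenius_norm_def sum_nonneg)
qed

end

section \<open>Independent columns\<close>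

context linear_model
begin

context
  fixes \<kappa> :: "nat \<Rightarrow> real"
  assumes n_pos: "0 < n"
    and cols: "indep_vars (\<lambda>_. borel_vec n) (design_col n X) {..<p}"
    and fourth_integrable: "\<And>j. j < p \<Longrightarrow> integrable M (\<lambda>\<omega>. (X 0 j \<omega>) ^ 4)"
    and fourth_moment: "\<And>j. j < p \<Longrightarrow> expectation (\<lambda>\<omega>. (X 0 j \<omega>) ^ 4) = \<kappa> j"
begin

text \<open>
  Mixed fourth moments of independent standardized variables. An index that occurs once gives zero,
  two distinct pairs give one. If all four indices agree, then the three pairings already count \<open>3\<close>,
  so the last term corrects this value, the Gaussian fourth moment, to \<open>\<kappa> j\<close>.
\<close>

lemma
  assumes less: "j < p" "k < p" "l < p" "m < p"
  shows X_quad_integrable: "integrable M (\<lambda>\<omega>. X 0 j \<omega> * (X 0 k \<omega> * (X 0 l \<omega> * X 0 m \<omega>)))"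
    and X_quad_moment: "expectation (\<lambda>\<omega>. X 0 j \<omega> * (X 0 k \<omega> * (X 0 l \<omega> * X 0 m \<omega>))) =
      (if j = k \<and> l = m then 1 else 0) + (if j = l \<and> k = m then 1 else 0) + (if j = m \<and> k = l then 1 else 0)
      + (if j = k \<and> j = l \<and> j = m then \<kappa> j - 3 else 0)"
proof -
  let ?L = "map (\<lambda>q. (q, \<lambda>c. c 0)) [j, k, l, m] :: (nat \<times> ((nat \<Rightarrow> real) \<Rightarrow> real)) list"
  let ?f = "\<lambda>q \<omega>. prod_list (map (\<lambda>(k, g). if k = q then g (design_col n X q \<omega>) else 1) ?L)"
  have col: "design_col n X q \<omega> 0 = X 0 q \<omega>" for q \<omega>
    using n_pos by (simp add: design_col_def)
  have meas: "k' \<in> {..<p} \<and> g \<in> borel_measurable (borel_vec n)" if "(k', g) \<in> set ?L" for k' g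
    using that less n_pos by auto
  have square: "integrable M (\<lambda>\<omega>. X 0 q \<omega> * X 0 q \<omega>)" if "q < p" for q
    using XX_integrable[OF n_pos that that] .
  have single: "integrable M (X 0 q)" if "q < p" for q
    using square[OF that] X_measurable[OF n_pos that]
    by (intro square_integrable_imp_integrable[of "X 0 q"]) (auto simp: power2_eq_square)
  have fourth: "integrable M (\<lambda>\<omega>. X 0 q \<omega> * (X 0 q \<omega> * (X 0 q \<omega> * X 0 q \<omega>)))" if "q < p" for q
    using fourth_integrable[OF that] by (simp add: power4_eq_xxxx mult.assoc)
  have third: "integrable M (\<lambda>\<omega>. X 0 q \<omega> * (X 0 q \<omega> * X 0 q \<omega>))" if "q < p" for q
    using that X_measurable[OF n_pos that] square[OF that] fourth[OF that]
    by (intro integrable_mult_of_squares) (auto simp: power2_eq_square mult.assoc)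
  have int: "integrable M (?f q)" if "q \<in> {..<p}" for q
  proof -
    have "q < p" using that by simp
    then show ?thesis
      by (cases "q = j"; cases "q = k"; cases "q = l"; cases "q = m")
         (auto simp: col single square third fourth)
  qed
  have regroup: "X 0 j \<omega> * (X 0 k \<omega> * (X 0 l \<omega> * X 0 m \<omega>)) =
      prod_list (map (\<lambda>(k, g). g (design_col n X k \<omega>)) ?L)" for \<omega>
    by (simp add: col)
  show "integrable M (\<lambda>\<omega>. X 0 j \<omega> * (X 0 k \<omega> * (X 0 l \<omega> * X 0 m \<omega>)))"
    unfolding regroup by (rule integrable_indep_prod_list[OF cols _ meas int]) auto
  have eq: "expectation (\<lambda>\<omega>. X 0 j \<omega> * (X 0 k \<omega> * (X 0 l \<omega> * X 0 m \<omega>))) = (\<Prod>q<p. expectation (?f q))"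
    unfolding regroup by (rule expectation_indep_prod_list[OF cols _ meas int]) auto
  consider (all) "j = k" "j = l" "j = m"
    | (isolated) "j \<notin> {k, l, m} \<or> k \<notin> {j, l, m} \<or> l \<notin> {j, k, m} \<or> m \<notin> {j, k, l}"
    | (pairs) "j = k \<and> l = m \<and> j \<noteq> l \<or> j = l \<and> k = m \<and> j \<noteq> k \<or> j = m \<and> k = l \<and> j \<noteq> k"
    by auto
  then show "expectation (\<lambda>\<omega>. X 0 j \<omega> * (X 0 k \<omega> * (X 0 l \<omega> * X 0 m \<omega>))) =
      (if j = k \<and> l = m then 1 else 0) + (if j = l \<and> k = m then 1 else 0) + (if j = m \<and> k = l then 1 else 0)
      + (if j = k \<and> j = l \<and> j = m then \<kappa> j - 3 else 0)"
  proof cases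
    case all
    then show ?thesis
      using fourth_moment[OF less(1)] by (simp add: power4_eq_xxxx mult.assoc)
  next
    case isolated
    define e where "e q = expectation (?f q)" for q
    have "e j = 0 \<or> e k = 0 \<or> e l = 0 \<or> e m = 0"
      using isolated less n_pos by (auto simp: e_def col X_mean)
    then have "\<exists>q\<in>{..<p}. e q = 0"
      using less by auto
    then have "(\<Prod>q<p. e q) = 0" by (intro prod_zero) auto
    then have zero: "(\<Prod>q<p. expectation (?f q)) = 0" unfolding e_def .
    have "\<not> (j = k \<and> l = m)" "\<not> (j = l \<and> k = m)" "\<not> (j = m \<and> k = l)" "\<not> (j = k \<and> j = l \<and> j = m)"
      using isolated by blast+
    then show ?thesis unfolding eq zero by (simp only: if_False add_0)
  next
    case pairs
    have "expectation (?f q) = 1" if "q < p" for q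
      using that pairs n_pos
      by (cases "q = j"; cases "q = k"; cases "q = l"; cases "q = m")
         (auto simp: col XX_moment prob_space)
    then have one: "(\<Prod>q<p. expectation (?f q)) = 1"
      by (intro prod.neutral ballI) (simp only: lessThan_iff)
    show ?thesis unfolding eq one using pairs by (elim disjE conjE) simp_all
  qed
qed

text \<open>
  Writing \<open>Y = s + \<epsilon>\<close> with the signal \<open>s = \<beta>\<^sup>T X\<close>, the term \<open>X\<^sub>j X\<^sub>k s\<^sup>2\<close> is a sum of mixed
  fourth moments, the cross term has mean zero, and \<open>X\<^sub>j X\<^sub>k \<epsilon>\<^sup>2\<close> has mean \<open>\<sigma>\<^sup>2\<close> if \<open>j = k\<close> and zero
  otherwise. So \<open>A\<close> is the rank-one matrix \<open>2 \<beta> \<beta>\<^sup>T\<close> plus a diagonal matrix, and this is why its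
  squared Frobenius norm grows at most like \<open>p\<close> and not like \<open>p\<^sup>2\<close>.
\<close>

lemma
  assumes j: "j < p" and k: "k < p"
  shows WW_integrable_of_fourth: "integrable M (\<lambda>\<omega>. W X Y 0 j \<omega> * W X Y 0 k \<omega>)"
    and A_formula: "A j k = 2 * \<beta> j * \<beta> k + (if j = k then \<tau>2 + \<sigma>\<^sup>2 + (\<beta> j)\<^sup>2 * (\<kappa> j - 3) else 0)"
proof -
  define s where "s \<omega> = (\<Sum>l<p. \<beta> l * X 0 l \<omega>)" for \<omega>
  have s_meas: "s \<in> borel_measurable (row_algebra 0)"
    unfolding s_def[abs_def] using n_pos
    by (intro borel_measurable_sum borel_measurable_times borel_measurable_const X_row_measurable) auto
  note row = X_row_measurable[OF n_pos]
  note meas [measurable] = X_measurable[OF n_pos] noise_measurable[OF n_pos]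
    row_measurable_imp_measurable[OF n_pos s_meas]
  have expand: "X 0 j \<omega> * X 0 k \<omega> * (s \<omega>)\<^sup>2 =
      (\<Sum>l<p. \<Sum>m<p. \<beta> l * \<beta> m * (X 0 j \<omega> * (X 0 k \<omega> * (X 0 l \<omega> * X 0 m \<omega>))))" for j k \<omega>
  proof -
    have "(s \<omega>)\<^sup>2 = (\<Sum>l<p. \<Sum>m<p. (\<beta> l * X 0 l \<omega>) * (\<beta> m * X 0 m \<omega>))"
      unfolding s_def power2_eq_square sum_product ..
    then show ?thesis
      by (simp add: sum_distrib_left mult_ac)
  qed
  have int0: "integrable M (\<lambda>\<omega>. \<beta> l * \<beta> m * (X 0 j \<omega> * (X 0 k \<omega> * (X 0 l \<omega> * X 0 m \<omega>))))"
    if "j < p" "k < p" "l \<in> {..<p}" "m \<in> {..<p}" for j k l m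
    using that by (intro integrable_mult_right X_quad_integrable) auto
  have int_s: "integrable M (\<lambda>\<omega>. X 0 j \<omega> * X 0 k \<omega> * (s \<omega>)\<^sup>2)" if "j < p" "k < p" for j k
    unfolding expand using that by (intro Bochner_Integration.integrable_sum int0)
  have int_Xs: "integrable M (\<lambda>\<omega>. (X 0 j \<omega> * s \<omega>)\<^sup>2)" if "j < p" for j
    using int_s[OF that that] by (simp add: power2_eq_square mult_ac)
  have int_Xe: "integrable M (\<lambda>\<omega>. (X 0 j \<omega> * \<epsilon> 0 \<omega>)\<^sup>2)" if "j < p" for j
    using that n_pos by (intro row_mult_noise_square_integrable row X_square_integrable)
  have "integrable M (\<lambda>\<omega>. (X 0 j \<omega> * s \<omega>) * (X 0 k \<omega> * \<epsilon> 0 \<omega>))"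
    using j k by (intro integrable_mult_of_squares int_Xs int_Xe) auto
  then have int_cross: "integrable M (\<lambda>\<omega>. X 0 j \<omega> * X 0 k \<omega> * s \<omega> * \<epsilon> 0 \<omega>)"
    by (simp add: mult_ac)
  have "integrable M (\<lambda>\<omega>. (X 0 j \<omega> * \<epsilon> 0 \<omega>) * (X 0 k \<omega> * \<epsilon> 0 \<omega>))"
    using j k by (intro integrable_mult_of_squares int_Xe) auto
  then have int_e: "integrable M (\<lambda>\<omega>. X 0 j \<omega> * X 0 k \<omega> * (\<epsilon> 0 \<omega>)\<^sup>2)"
    by (simp add: mult_ac power2_eq_square)
  have WW: "W X Y 0 j \<omega> * W X Y 0 k \<omega> = X 0 j \<omega> * X 0 k \<omega> * (s \<omega>)\<^sup>2
      + 2 * (X 0 j \<omega> * X 0 k \<omega> * s \<omega> * \<epsilon> 0 \<omega>) + X 0 j \<omega> * X 0 k \<omega> * (\<epsilon> 0 \<omega>)\<^sup>2"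
    if "\<omega> \<in> space M" for \<omega>
    using linear[OF n_pos that] by (simp add: W_def s_def[symmetric] power2_eq_square algebra_simps)
  have "integrable M (\<lambda>\<omega>. X 0 j \<omega> * X 0 k \<omega> * (s \<omega>)\<^sup>2
      + 2 * (X 0 j \<omega> * X 0 k \<omega> * s \<omega> * \<epsilon> 0 \<omega>) + X 0 j \<omega> * X 0 k \<omega> * (\<epsilon> 0 \<omega>)\<^sup>2)"
    using int_s[OF j k] int_cross int_e by (intro Bochner_Integration.integrable_add integrable_mult_right)
  then show "integrable M (\<lambda>\<omega>. W X Y 0 j \<omega> * W X Y 0 k \<omega>)"
    by (subst Bochner_Integration.integrable_cong[OF refl WW])
  have cross: "expectation (\<lambda>\<omega>. X 0 j \<omega> * X 0 k \<omega> * s \<omega> * \<epsilon> 0 \<omega>) = 0"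
    using j k by (intro noise_orthogonal[OF n_pos _ int_cross] borel_measurable_times s_meas row)
  have noise: "expectation (\<lambda>\<omega>. X 0 j \<omega> * X 0 k \<omega> * (\<epsilon> 0 \<omega>)\<^sup>2) = (if j = k then \<sigma>\<^sup>2 else 0)"
    using noise_square_moment[OF n_pos borel_measurable_times[OF row[OF j] row[OF k]] int_e] XX_moment[OF n_pos j k]
    by simp
  have "expectation (\<lambda>\<omega>. X 0 j \<omega> * X 0 k \<omega> * (s \<omega>)\<^sup>2) = (\<Sum>l<p. \<Sum>m<p.
      expectation (\<lambda>\<omega>. \<beta> l * \<beta> m * (X 0 j \<omega> * (X 0 k \<omega> * (X 0 l \<omega> * X 0 m \<omega>)))))"
    unfolding expand using j k by (intro integral_double_sum int0)
  also have "\<dots> = (\<Sum>l<p. \<Sum>m<p.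
      (if m = l then if j = k then \<beta> l * \<beta> m else 0 else 0)
      + (if m = k then if l = j then \<beta> l * \<beta> m else 0 else 0)
      + (if m = j then if l = k then \<beta> l * \<beta> m else 0 else 0)
      + (if m = j then if l = j then if j = k then \<beta> l * \<beta> m * (\<kappa> j - 3) else 0 else 0 else 0))"
    using j k by (intro sum.cong refl) (auto simp: X_quad_moment algebra_simps)
  also have "\<dots> = (if j = k then \<tau>2 else 0) + \<beta> j * \<beta> k + \<beta> k * \<beta> j
      + (if j = k then (\<beta> j)\<^sup>2 * (\<kappa> j - 3) else 0)"
    using j k by (simp add: sum.distrib signal_level_def power2_eq_square)
  finally have signal: "expectation (\<lambda>\<omega>. X 0 j \<omega> * X 0 k \<omega> * (s \<omega>)\<^sup>2) =
      (if j = k then \<tau>2 else 0) + \<beta> j * \<beta> k + \<beta> k * \<beta> j + (if j = k then (\<beta> j)\<^sup>2 * (\<kappa> j - 3) else 0)" .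
  have "A j k = expectation (\<lambda>\<omega>. X 0 j \<omega> * X 0 k \<omega> * (s \<omega>)\<^sup>2
      + 2 * (X 0 j \<omega> * X 0 k \<omega> * s \<omega> * \<epsilon> 0 \<omega>) + X 0 j \<omega> * X 0 k \<omega> * (\<epsilon> 0 \<omega>)\<^sup>2)"
    unfolding A_mat_def by (rule Bochner_Integration.integral_cong[OF refl WW])
  also have "\<dots> = expectation (\<lambda>\<omega>. X 0 j \<omega> * X 0 k \<omega> * (s \<omega>)\<^sup>2)
      + 2 * expectation (\<lambda>\<omega>. X 0 j \<omega> * X 0 k \<omega> * s \<omega> * \<epsilon> 0 \<omega>) + expectation (\<lambda>\<omega>. X 0 j \<omega> * X 0 k \<omega> * (\<epsilon> 0 \<omega>)\<^sup>2)"
    using int_s[OF j k] int_cross int_e by simp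
  finally show "A j k = 2 * \<beta> j * \<beta> k + (if j = k then \<tau>2 + \<sigma>\<^sup>2 + (\<beta> j)\<^sup>2 * (\<kappa> j - 3) else 0)"
    by (simp add: cross noise signal)
qed

end

end

lemma
  fixes B :: "nat \<Rightarrow> nat \<Rightarrow> real"
  assumes B: "\<And>j k. j < p \<Longrightarrow> k < p \<Longrightarrow> B j k = 2 * \<beta> j * \<beta> k + (if j = k then d j else 0)"
    and d: "\<And>j. j < p \<Longrightarrow> \<bar>d j\<bar> \<le> D"
  shows frobenius_norm_rank_one_plus_diagonal:
      "(frobenius_norm p B)\<^sup>2 \<le> 8 * (signal_level p \<beta>)\<^sup>2 + 2 * real p * D\<^sup>2"
    and quadratic_form_rank_one_plus_diagonal:
      "(\<Sum>j<p. \<Sum>k<p. \<beta> j * \<beta> k * B j k) \<le> 2 * (signal_level p \<beta>)\<^sup>2 + signal_level p \<beta> * D"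
proof -
  have "(frobenius_norm p B)\<^sup>2 = (\<Sum>j<p. \<Sum>k<p. (B j k)\<^sup>2)"
    by (simp add: frobenius_norm_def sum_nonneg)
  also have "\<dots> \<le> (\<Sum>j<p. \<Sum>k<p. 8 * (\<beta> j * \<beta> k)\<^sup>2 + (if j = k then 2 * D\<^sup>2 else 0))"
  proof (intro sum_mono)
    fix j k assume "j \<in> {..<p}" "k \<in> {..<p}"
    then have jk: "j < p" "k < p" by auto
    have two: "(x + y)\<^sup>2 \<le> 2 * x\<^sup>2 + 2 * y\<^sup>2" for x y :: real
      using sum_squares_bound[of x y] by (simp add: power2_sum)
    have "(d j)\<^sup>2 \<le> D\<^sup>2"
      using power_mono[OF d[OF jk(1)], of 2] by simp
    then show "(B j k)\<^sup>2 \<le> 8 * (\<beta> j * \<beta> k)\<^sup>2 + (if j = k then 2 * D\<^sup>2 else 0)"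
      using two[of "2 * \<beta> j * \<beta> k" "d j"] B[OF jk] by (auto simp: power_mult_distrib)
  qed
  also have "\<dots> = 8 * (signal_level p \<beta>)\<^sup>2 + 2 * real p * D\<^sup>2"
    by (simp add: sum.distrib sum_distrib_left[symmetric] signal_level_square)
  finally show "(frobenius_norm p B)\<^sup>2 \<le> 8 * (signal_level p \<beta>)\<^sup>2 + 2 * real p * D\<^sup>2" .
  have "(\<Sum>j<p. \<Sum>k<p. \<beta> j * \<beta> k * B j k) =
      (\<Sum>j<p. \<Sum>k<p. 2 * (\<beta> j * \<beta> k)\<^sup>2 + (if j = k then (\<beta> j)\<^sup>2 * d j else 0))"
    by (intro sum.cong refl) (auto simp: B power2_eq_square algebra_simps)
  also have "\<dots> = 2 * (signal_level p \<beta>)\<^sup>2 + (\<Sum>j<p. (\<beta> j)\<^sup>2 * d j)"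
    by (simp add: sum.distrib sum_distrib_left[symmetric] signal_level_square)
  also have "(\<Sum>j<p. (\<beta> j)\<^sup>2 * d j) \<le> (\<Sum>j<p. (\<beta> j)\<^sup>2 * D)"
    using d by (intro sum_mono mult_left_mono) (auto simp: abs_le_iff)
  also have "\<dots> = signal_level p \<beta> * D"
    by (simp add: signal_level_def sum_distrib_right)
  finally show "(\<Sum>j<p. \<Sum>k<p. \<beta> j * \<beta> k * B j k) \<le> 2 * (signal_level p \<beta>)\<^sup>2 + signal_level p \<beta> * D"
    by simp
qed

section \<open>From second moments to rates in probability\<close>

lemma (in finite_measure) prob_gt_le_second_moment:
  fixes f :: "'a \<Rightarrow> real"
  assumes meas: "f \<in> borel_measurable M" and int: "integrable M (\<lambda>\<omega>. (f \<omega>)\<^sup>2)"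
    and bound: "(\<integral>\<omega>. (f \<omega>)\<^sup>2 \<partial>M) \<le> B" and a: "a > 0"
  shows "measure M {\<omega> \<in> space M. \<bar>f \<omega>\<bar> > a} \<le> B / a\<^sup>2"
proof -
  have "measure M {\<omega> \<in> space M. \<bar>f \<omega>\<bar> > a} \<le> measure M {\<omega> \<in> space M. \<bar>f \<omega>\<bar> \<ge> a}"
    using meas by (intro finite_measure_mono) auto
  also have "\<dots> \<le> (\<integral>\<omega>. (f \<omega>)\<^sup>2 \<partial>M) / a\<^sup>2"
    by (rule second_moment_method[OF meas int a])
  also have "\<dots> \<le> B / a\<^sup>2"
    using bound by (rule divide_right_mono) simp
  finally show ?thesis .
qed

lemma tendsto_0_in_prob_of_second_moment:
  assumes "\<forall>\<^sub>F n in sequentially. prob_space (M n) \<and> Z n \<in> borel_measurable (M n) \<and>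
      integrable (M n) (\<lambda>\<omega>. (Z n \<omega>)\<^sup>2) \<and> (\<integral>\<omega>. (Z n \<omega>)\<^sup>2 \<partial>M n) \<le> B n"
    and "B \<longlonglongrightarrow> 0"
  shows "tendsto_0_in_prob M Z"
  unfolding tendsto_0_in_prob_def
proof (intro conjI allI impI)
  show "\<forall>\<^sub>F n in sequentially. Z n \<in> borel_measurable (M n)"
    using assms(1) by eventually_elim simp
  fix e :: real assume e: "e > 0"
  show "(\<lambda>n. measure (M n) {\<omega> \<in> space (M n). \<bar>Z n \<omega>\<bar> > e}) \<longlonglongrightarrow> 0"
  proof (rule tendsto_sandwich[OF _ _ tendsto_const])
    show "\<forall>\<^sub>F n in sequentially. measure (M n) {\<omega> \<in> space (M n). \<bar>Z n \<omega>\<bar> > e} \<le> B n / e\<^sup>2"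
      using assms(1)
    proof eventually_elim
      case (elim n)
      then interpret prob_space "M n" by simp
      show ?case using elim e by (intro prob_gt_le_second_moment) auto
    qed
    show "(\<lambda>n. B n / e\<^sup>2) \<longlonglongrightarrow> 0"
      using tendsto_divide[OF assms(2) tendsto_const, of "e\<^sup>2"] e by simp
  qed simp
qed

lemma bounded_in_prob_of_second_moment:
  assumes ev: "\<forall>\<^sub>F n in sequentially. prob_space (M n) \<and> Z n \<in> borel_measurable (M n) \<and>
      integrable (M n) (\<lambda>\<omega>. (Z n \<omega>)\<^sup>2) \<and> (\<integral>\<omega>. (Z n \<omega>)\<^sup>2 \<partial>M n) \<le> B"
  shows "bounded_in_prob M Z"
  unfolding bounded_in_prob_def
proof (intro conjI allI impI)
  show "\<forall>\<^sub>F n in sequentially. Z n \<in> borel_measurable (M n)"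
    using ev by eventually_elim simp
  fix e :: real assume e: "e > 0"
  \<comment> \<open>Chebyshev gives \<open>B / K\<^sup>2\<close>, which has to be strictly below \<open>e\<close> whatever the sign of \<open>B\<close>.\<close>
  define K where "K = sqrt ((\<bar>B\<bar> + 1) / e)"
  have K: "K > 0" "K\<^sup>2 = (\<bar>B\<bar> + 1) / e"
    using e by (simp_all add: K_def)
  have "B / K\<^sup>2 < e"
    using e mult_strict_right_mono[of B "\<bar>B\<bar> + 1" e] by (simp add: K(2) field_simps)
  have "\<forall>\<^sub>F n in sequentially. measure (M n) {\<omega> \<in> space (M n). \<bar>Z n \<omega>\<bar> > K} < e"
    using ev
  proof eventually_elim
    case (elim n)
    then interpret prob_space "M n" by simp
    have "measure (M n) {\<omega> \<in> space (M n). \<bar>Z n \<omega>\<bar> > K} \<le> B / K\<^sup>2"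
      using elim K by (intro prob_gt_le_second_moment) auto
    with \<open>B / K\<^sup>2 < e\<close> show ?case by simp
  qed
  then show "\<exists>K. \<forall>\<^sub>F n in sequentially. measure (M n) {\<omega> \<in> space (M n). \<bar>Z n \<omega>\<bar> > K} < e" ..
qed

section \<open>Consistency of the naive estimator\<close>

text \<open>
  The diagonal part of \<open>A\<close> is at most \<open>K + K (C + 3)\<close> in absolute value, because \<open>\<beta>\<^sub>j\<^sup>2 \<le> \<tau>\<^sup>2 \<le> K\<close>
  and fourth moments lie between \<open>0\<close> and \<open>C\<close>.
\<close>

lemma (in linear_model) independent_columns_bounds:
  assumes n: "0 < n"
    and cols: "indep_vars (\<lambda>_. borel_vec n) (design_col n X) {..<p}"
    and fourth: "\<And>j. j < p \<Longrightarrow> integrable M (\<lambda>\<omega>. (X 0 j \<omega>) ^ 4) \<and> expectation (\<lambda>\<omega>. (X 0 j \<omega>) ^ 4) \<le> C"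
    and C: "0 \<le> C" and level: "\<tau>2 + \<sigma>\<^sup>2 \<le> K"
  shows "A_exists M p X Y"
    and "(frobenius_norm p A)\<^sup>2 \<le> 8 * K\<^sup>2 + 2 * real p * (K * (C + 4))\<^sup>2"
    and "(\<Sum>j<p. \<Sum>k<p. \<beta> j * \<beta> k * A j k) \<le> 2 * K\<^sup>2 + K * (K * (C + 4))"
proof -
  define \<kappa> where "\<kappa> j = expectation (\<lambda>\<omega>. (X 0 j \<omega>) ^ 4)" for j
  define d where "d j = \<tau>2 + \<sigma>\<^sup>2 + (\<beta> j)\<^sup>2 * (\<kappa> j - 3)" for j
  show "A_exists M p X Y"
    unfolding A_exists_def using fourth
    by (intro allI impI WW_integrable_of_fourth[OF n cols, where \<kappa> = \<kappa>]) (simp_all add: \<kappa>_def)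
  have formula: "A j k = 2 * \<beta> j * \<beta> k + (if j = k then d j else 0)" if "j < p" "k < p" for j k
    unfolding d_def using fourth that by (intro A_formula[OF n cols]) (simp_all add: \<kappa>_def)
  have \<tau>2: "0 \<le> \<tau>2" "\<tau>2 \<le> K"
    using level zero_le_power2[of \<sigma>] by (simp add: signal_level_def sum_nonneg, linarith)
  have d: "\<bar>d j\<bar> \<le> K * (C + 4)" if "j < p" for j
  proof -
    have "(\<beta> j)\<^sup>2 \<le> \<tau>2"
      unfolding signal_level_def using that by (intro member_le_sum) auto
    then have \<beta>: "(\<beta> j)\<^sup>2 \<le> K" using \<tau>2 by simp
    have "0 \<le> \<kappa> j" unfolding \<kappa>_def by (intro integral_nonneg_AE) simp
    moreover have "\<kappa> j \<le> C" using fourth[OF that] by (simp add: \<kappa>_def)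
    ultimately have "\<bar>\<kappa> j - 3\<bar> \<le> C + 3" using C by (simp add: abs_le_iff)
    then have "\<bar>(\<beta> j)\<^sup>2 * (\<kappa> j - 3)\<bar> \<le> K * (C + 3)"
      using \<beta> \<tau>2 unfolding abs_mult by (intro mult_mono) auto
    moreover have "\<bar>\<tau>2 + \<sigma>\<^sup>2\<bar> \<le> K" using level \<tau>2 by simp
    ultimately show ?thesis unfolding d_def by (simp add: algebra_simps abs_le_iff)
  qed
  have "(frobenius_norm p A)\<^sup>2 \<le> 8 * \<tau>2\<^sup>2 + 2 * real p * (K * (C + 4))\<^sup>2"
    by (rule frobenius_norm_rank_one_plus_diagonal[OF formula d])
  then show "(frobenius_norm p A)\<^sup>2 \<le> 8 * K\<^sup>2 + 2 * real p * (K * (C + 4))\<^sup>2"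
    using power_mono[OF \<tau>2(2,1), of 2] by simp
  have "(\<Sum>j<p. \<Sum>k<p. \<beta> j * \<beta> k * A j k) \<le> 2 * \<tau>2\<^sup>2 + \<tau>2 * (K * (C + 4))"
    by (rule quadratic_form_rank_one_plus_diagonal[OF formula d])
  also have "\<dots> \<le> 2 * K\<^sup>2 + K * (K * (C + 4))"
    using power_mono[OF \<tau>2(2,1), of 2] \<tau>2 C by (intro add_mono mult_right_mono) auto
  finally show "(\<Sum>j<p. \<Sum>k<p. \<beta> j * \<beta> k * A j k) \<le> 2 * K\<^sup>2 + K * (K * (C + 4))" .
qed

theorem proposition2p2:
  fixes M :: "nat \<Rightarrow> 'a measure"
    and p :: "nat \<Rightarrow> nat"
    and X :: "nat \<Rightarrow> nat \<Rightarrow> nat \<Rightarrow> 'a \<Rightarrow> real"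
    and Y \<epsilon> :: "nat \<Rightarrow> nat \<Rightarrow> 'a \<Rightarrow> real"
    and \<beta> :: "nat \<Rightarrow> nat \<Rightarrow> real"
    and \<sigma> :: "nat \<Rightarrow> real"
  assumes model: "\<And>n. n \<ge> 2 \<Longrightarrow> linear_model (M n) n (p n) (X n) (Y n) (\<epsilon> n) (\<beta> n) (\<sigma> n)"
    and bounded_levels: "(\<lambda>n. signal_level (p n) (\<beta> n) + (\<sigma> n)\<^sup>2) \<in> O(\<lambda>_. 1)"
  shows
    "((\<forall>n\<ge>2. A_exists (M n) (p n) (X n) (Y n)) \<and>
      (\<lambda>n. (frobenius_norm (p n) (A_mat (M n) (X n) (Y n)))\<^sup>2 / (real n)\<^sup>2) \<longlonglongrightarrow> 0
      \<longrightarrow> consistent M (\<lambda>n. naive_estimator n (p n) (X n) (Y n)) (\<lambda>n. signal_level (p n) (\<beta> n)))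
     \<and>
     ((\<forall>n\<ge>2. prob_space.indep_vars (M n) (\<lambda>_. borel_vec n) (design_col n (X n)) {..<p n}) \<and>
      (\<exists>C. \<forall>n\<ge>2. real (p n) / real n \<le> C) \<and>
      (\<exists>C. \<forall>n\<ge>2. \<forall>i<n. \<forall>j<p n.
          integrable (M n) (\<lambda>\<omega>. (X n i j \<omega>) ^ 4) \<and> (\<integral>\<omega>. (X n i j \<omega>) ^ 4 \<partial>M n) \<le> C)
      \<longrightarrow> (\<forall>n\<ge>2. A_exists (M n) (p n) (X n) (Y n)) \<and>
          (\<lambda>n. (frobenius_norm (p n) (A_mat (M n) (X n) (Y n)))\<^sup>2 / (real n)\<^sup>2) \<longlonglongrightarrow> 0 \<and>
          root_n_consistent M (\<lambda>n. naive_estimator n (p n) (X n) (Y n))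
            (\<lambda>n. signal_level (p n) (\<beta> n)))"
proof -
  define T where "T n = naive_estimator n (p n) (X n) (Y n)" for n
  define t where "t n = signal_level (p n) (\<beta> n)" for n
  define F where "F n = frobenius_norm (p n) (A_mat (M n) (X n) (Y n))" for n
  define q where "q n = (\<Sum>j<p n. \<Sum>k<p n. \<beta> n j * \<beta> n k * A_mat (M n) (X n) (Y n) j k)" for n
  obtain K where K: "K > 0" and evK: "\<forall>\<^sub>F n in sequentially. t n + (\<sigma> n)\<^sup>2 \<le> K"
  proof -
    obtain K where "K > 0" and ev: "\<forall>\<^sub>F n in sequentially. norm (t n + (\<sigma> n)\<^sup>2) \<le> K * norm (1 :: real)"
      using bounded_levels unfolding t_def by (elim landau_o.bigE)
    have "\<forall>\<^sub>F n in sequentially. t n + (\<sigma> n)\<^sup>2 \<le> K"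
      using ev by eventually_elim simp
    with \<open>K > 0\<close> that show thesis by blast
  qed
  have t0: "0 \<le> t n" for n by (simp add: t_def signal_level_def sum_nonneg)
  have F0: "0 \<le> F n" for n by (simp add: F_def frobenius_norm_def sum_nonneg)
  have qF: "q n \<le> t n * F n" if "n \<ge> 2" for n
    unfolding q_def t_def F_def by (rule linear_model.quadratic_form_le_frobenius[OF model[OF that]])
  have prob: "prob_space (M n)" if "n \<ge> 2" for n
    using model[OF that] by (rule linear_model.axioms)
  have T_meas: "T n \<in> borel_measurable (M n)" if "n \<ge> 2" for n
    unfolding T_def by (rule linear_model.naive_estimator_measurable[OF model[OF that]])
  have T_int: "integrable (M n) (\<lambda>\<omega>. (T n \<omega> - t n)\<^sup>2)"
    and T_moment: "(\<integral>\<omega>. (T n \<omega> - t n)\<^sup>2 \<partial>M n) \<le> 16 * ((F n)\<^sup>2 + (t n)\<^sup>2) / (real n)\<^sup>2 + 8 * q n / real n"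
    if "n \<ge> 2" "A_exists (M n) (p n) (X n) (Y n)" for n
    unfolding T_def t_def F_def q_def
    by (rule linear_model.naive_estimator_error_second_moment[OF model[OF that(1)] that(2,1)])+
  have part1: "consistent M T t"
    if ex: "\<forall>n\<ge>2. A_exists (M n) (p n) (X n) (Y n)" and lim: "(\<lambda>n. (F n)\<^sup>2 / (real n)\<^sup>2) \<longlonglongrightarrow> 0"
    unfolding consistent_def
  proof (rule tendsto_0_in_prob_of_second_moment)
    \<comment> \<open>The quadratic form is at most \<open>K\<close> times the Frobenius norm, and \<open>F n / n\<close> is the square root of a null sequence.\<close>
    let ?B = "\<lambda>n. 16 * ((F n)\<^sup>2 / (real n)\<^sup>2 + K\<^sup>2 / (real n)\<^sup>2) + 8 * K * sqrt ((F n)\<^sup>2 / (real n)\<^sup>2)"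
    show "\<forall>\<^sub>F n in sequentially. prob_space (M n) \<and> (\<lambda>\<omega>. T n \<omega> - t n) \<in> borel_measurable (M n) \<and>
      integrable (M n) (\<lambda>\<omega>. (T n \<omega> - t n)\<^sup>2) \<and> (\<integral>\<omega>. (T n \<omega> - t n)\<^sup>2 \<partial>M n) \<le> ?B n"
      using evK eventually_ge_at_top[of 2]
    proof eventually_elim
      case (elim n)
      have tK: "t n \<le> K" using elim(1) zero_le_power2[of "\<sigma> n"] by linarith
      have "q n \<le> K * F n"
        using qF[OF elim(2)] mult_right_mono[OF tK F0[of n]] by linarith
      then have "8 * q n / real n \<le> 8 * (K * F n) / real n"
        by (intro divide_right_mono) auto
      also have "\<dots> = 8 * K * sqrt ((F n)\<^sup>2 / (real n)\<^sup>2)"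
        using F0[of n] by (simp add: real_sqrt_divide)
      finally have "8 * q n / real n \<le> 8 * K * sqrt ((F n)\<^sup>2 / (real n)\<^sup>2)" .
      moreover have "16 * ((F n)\<^sup>2 + (t n)\<^sup>2) / (real n)\<^sup>2 \<le> 16 * ((F n)\<^sup>2 / (real n)\<^sup>2 + K\<^sup>2 / (real n)\<^sup>2)"
        using power_mono[OF tK t0[of n], of 2]
        by (simp add: add_divide_distrib[symmetric] divide_right_mono)
      ultimately have "(\<integral>\<omega>. (T n \<omega> - t n)\<^sup>2 \<partial>M n) \<le> ?B n"
        using T_moment[OF elim(2)] ex elim(2) by force
      then show ?case
        using prob T_meas T_int ex elim(2) by simp
    qed
    have "(\<lambda>n. K\<^sup>2 / (real n)\<^sup>2) \<longlonglongrightarrow> 0"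
      by real_asymp
    then have "?B \<longlonglongrightarrow> 16 * (0 + 0) + 8 * K * sqrt 0"
      by (intro tendsto_intros lim)
    then show "?B \<longlonglongrightarrow> 0" by simp
  qed
  have part2: "(\<forall>n\<ge>2. A_exists (M n) (p n) (X n) (Y n)) \<and> (\<lambda>n. (F n)\<^sup>2 / (real n)\<^sup>2) \<longlonglongrightarrow> 0 \<and>
      root_n_consistent M T t"
    if cols: "\<forall>n\<ge>2. prob_space.indep_vars (M n) (\<lambda>_. borel_vec n) (design_col n (X n)) {..<p n}"
      and ratio: "\<forall>n\<ge>2. real (p n) / real n \<le> R"
      and fourth: "\<forall>n\<ge>2. \<forall>i<n. \<forall>j<p n.
          integrable (M n) (\<lambda>\<omega>. (X n i j \<omega>) ^ 4) \<and> (\<integral>\<omega>. (X n i j \<omega>) ^ 4 \<partial>M n) \<le> C0" for R C0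
  proof -
    \<comment> \<open>The bound \<open>C0\<close> may be negative if there are no columns at all.\<close>
    define C where "C = max C0 0"
    have C: "0 \<le> C" "C0 \<le> C" by (auto simp: C_def)
    have fourth0: "integrable (M n) (\<lambda>\<omega>. (X n 0 j \<omega>) ^ 4) \<and> (\<integral>\<omega>. (X n 0 j \<omega>) ^ 4 \<partial>M n) \<le> C"
      if "n \<ge> 2" "j < p n" for n j
    proof -
      have "0 < n" using that(1) by simp
      with fourth that show ?thesis using C(2) order_trans by blast
    qed
    note bounds = linear_model.independent_columns_bounds[OF model _ cols[rule_format] fourth0 C(1)]
    have ex: "A_exists (M n) (p n) (X n) (Y n)" if "n \<ge> 2" for n
      using that by (intro bounds(1)[OF that _ that that]) auto
    \<comment> \<open>The squared Frobenius norm is of order \<open>p\<close>, hence of order \<open>n\<close>.\<close>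
    define G where "G = 8 * K\<^sup>2 + 2 * R * (K * (C + 4))\<^sup>2"
    have evb: "\<forall>\<^sub>F n in sequentially. n \<ge> 2 \<and> t n \<le> K \<and> (F n)\<^sup>2 \<le> G * real n \<and> q n \<le> 2 * K\<^sup>2 + K * (K * (C + 4))"
      using evK eventually_ge_at_top[of 2]
    proof eventually_elim
      case (elim n)
      have n: "0 < n" "1 \<le> real n" using elim(2) by auto
      have "real (p n) \<le> R * real n"
        using ratio elim(2) n by (simp add: field_simps)
      then have "2 * real (p n) * (K * (C + 4))\<^sup>2 \<le> 2 * (R * real n) * (K * (C + 4))\<^sup>2"
        by (intro mult_right_mono) auto
      moreover have "8 * K\<^sup>2 \<le> 8 * K\<^sup>2 * real n"
        using n(2) mult_left_mono[of 1 "real n" "8 * K\<^sup>2"] by simp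
      moreover have "(F n)\<^sup>2 \<le> 8 * K\<^sup>2 + 2 * real (p n) * (K * (C + 4))\<^sup>2"
        unfolding F_def using elim n unfolding t_def by (intro bounds(2)) auto
      ultimately have "(F n)\<^sup>2 \<le> G * real n"
        unfolding G_def by (simp add: algebra_simps)
      moreover have "q n \<le> 2 * K\<^sup>2 + K * (K * (C + 4))"
        unfolding q_def using elim n unfolding t_def by (intro bounds(3)) auto
      moreover have "t n \<le> K" using elim(1) zero_le_power2[of "\<sigma> n"] by linarith
      ultimately show ?case using elim(2) by simp
    qed
    have lim: "(\<lambda>n. (F n)\<^sup>2 / (real n)\<^sup>2) \<longlonglongrightarrow> 0"
    proof (rule tendsto_sandwich[OF _ _ tendsto_const])
      show "\<forall>\<^sub>F n in sequentially. (F n)\<^sup>2 / (real n)\<^sup>2 \<le> G / real n"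
        using evb
      proof eventually_elim
        case (elim n)
        then have "(F n)\<^sup>2 / (real n)\<^sup>2 \<le> G * real n / (real n)\<^sup>2"
          by (intro divide_right_mono) auto
        also have "\<dots> = G / real n"
          using elim by (simp add: power2_eq_square)
        finally show ?case .
      qed
      show "(\<lambda>n. G / real n) \<longlonglongrightarrow> 0" by real_asymp
    qed simp
    have root: "root_n_consistent M T t"
      unfolding root_n_consistent_def
    proof (rule bounded_in_prob_of_second_moment)
      let ?B = "16 * (G + K\<^sup>2) + 8 * (2 * K\<^sup>2 + K * (K * (C + 4)))"
      show "\<forall>\<^sub>F n in sequentially. prob_space (M n) \<and>
        (\<lambda>\<omega>. sqrt (real n) * (T n \<omega> - t n)) \<in> borel_measurable (M n) \<and>
        integrable (M n) (\<lambda>\<omega>. (sqrt (real n) * (T n \<omega> - t n))\<^sup>2) \<and>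
        (\<integral>\<omega>. (sqrt (real n) * (T n \<omega> - t n))\<^sup>2 \<partial>M n) \<le> ?B"
        using evb
      proof eventually_elim
        case (elim n)
        then have n: "n \<ge> 2" "1 \<le> real n" by auto
        have scale: "(sqrt (real n) * (T n \<omega> - t n))\<^sup>2 = real n * (T n \<omega> - t n)\<^sup>2" for \<omega>
          by (simp add: power_mult_distrib)
        have "(t n)\<^sup>2 \<le> K\<^sup>2" using elim t0[of n] by (intro power_mono) auto
        also have "\<dots> \<le> K\<^sup>2 * real n"
          using n(2) mult_left_mono[of 1 "real n" "K\<^sup>2"] by simp
        finally have tn: "(F n)\<^sup>2 + (t n)\<^sup>2 \<le> (G + K\<^sup>2) * real n"
          using elim by (simp add: distrib_right)
        have "real n * (\<integral>\<omega>. (T n \<omega> - t n)\<^sup>2 \<partial>M n) \<le>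
            real n * (16 * ((F n)\<^sup>2 + (t n)\<^sup>2) / (real n)\<^sup>2 + 8 * q n / real n)"
          by (intro mult_left_mono T_moment n ex) auto
        also have "\<dots> = 16 * (((F n)\<^sup>2 + (t n)\<^sup>2) / real n) + 8 * q n"
          using n by (simp add: field_simps power2_eq_square)
        also have "\<dots> \<le> ?B"
        proof -
          have "((F n)\<^sup>2 + (t n)\<^sup>2) / real n \<le> G + K\<^sup>2"
            using tn n by (simp add: pos_divide_le_eq)
          then show ?thesis using elim by (intro add_mono mult_left_mono) auto
        qed
        finally show ?case
          using prob[OF n(1)] T_meas[OF n(1)] T_int[OF n(1) ex[OF n(1)]] by (simp add: scale)
      qed
    qed
    from ex lim root show ?thesis by blast
  qed
  show ?thesis
    using part1 part2 unfolding T_def t_def F_def by blast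
qed

end
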